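(* (1) If $G$ is a noncompact locally compact $IN$-group, then $WS(G)\supsetneq AP(G)$. (2) If $G$ is a noncompact locally compact nilpotent group, then $WS(G)\supsetneq AP(G)$.
   Context: A locally compact group $G$ is an $IN$-group if it has a compact neighborhood of the identity that is invariant under all inner automorphisms of $G$. For a locally compact group $G$, $C(G)$ denotes the $C^*$-algebra of bounded continuous complex-valued functions on $G$ with the sup norm. For $f\in C(G)$ and $x,y\in G$ put ${}_xf(z)=f(xz)$ and ${}_xf_y(z)=f(xzy)$; $O_L(f)=\{{}_xf:x\in G\}$ and $O(f)=\{{}_xf_y: x,y\in G\}$. $AP(G)$ is the set of $f\in C(G)$ with $O_L(f)$ relatively norm compact in $C(G)$ (equivalently, with $O(f)$ relatively norm compact). $WS(G)$ is the set of $f\in C(G)$ with $O(f)$ relatively weakly compact in $C(G)$. *)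

theory Defs
  imports "HOL-Analysis.Analysis"
begin

text \<open>
  Groups are types of class \<open>topological_group_add\<close>. The class \<open>group_add\<close> does not include
  commutativity; the product \<open>x y\<close> of a (possibly nonabelian) group is written \<open>x + y\<close>, its
  identity \<open>0\<close>, and the inverse of \<open>x\<close> is \<open>- x\<close>, with \<open>x - y = x + (- y)\<close>.
  The space \<open>C(G)\<close> is the type \<open>'a \<Rightarrow>\<^sub>C complex\<close> with the supremum norm.
\<close>

definition IN_group :: "'a::topological_group_add itself \<Rightarrow> bool" where
  "IN_group _ \<longleftrightarrow>
     (\<exists>K::'a set. compact K \<and> 0 \<in> interior K \<and> (\<forall>x. (\<lambda>z. x + z - x) ` K = K))"

text \<open>
  The upper central series: \<open>x + y - x - y\<close> is the commutator of \<open>x\<close> and \<open>y\<close>, so the successor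
  step is the preimage of the centre of the quotient by the preceding term.
\<close>

primrec upper_central :: "nat \<Rightarrow> 'a::group_add set" where
  "upper_central 0 = {0}"
| "upper_central (Suc n) = {x. \<forall>y. x + y - x - y \<in> upper_central n}"

definition nilpotent_group :: "'a::group_add itself \<Rightarrow> bool" where
  "nilpotent_group _ \<longleftrightarrow> (\<exists>n. upper_central n = (UNIV :: 'a set))"

context
  includes bcontfun.lifting
begin

lift_definition left_translate ::
  "'a::topological_group_add \<Rightarrow> ('a \<Rightarrow>\<^sub>C complex) \<Rightarrow> ('a \<Rightarrow>\<^sub>C complex)"
  is "\<lambda>x f z. f (x + z)"
proof -
  fix x :: 'a and f :: "'a \<Rightarrow> complex"
  assume f: "f \<in> bcontfun"
  have "continuous_on UNIV (\<lambda>z. f (x + z))"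
    by (rule continuous_on_compose2[of UNIV f])
      (use f in \<open>auto simp: bcontfun_def intro!: continuous_intros\<close>)
  moreover have "bounded (range (\<lambda>z. f (x + z)))"
    by (rule bounded_subset[of "range f"]) (use f in \<open>auto simp: bcontfun_def\<close>)
  ultimately show "(\<lambda>z. f (x + z)) \<in> bcontfun"
    by (simp add: bcontfun_def)
qed

lift_definition two_sided_translate ::
  "'a::topological_group_add \<Rightarrow> 'a \<Rightarrow> ('a \<Rightarrow>\<^sub>C complex) \<Rightarrow> ('a \<Rightarrow>\<^sub>C complex)"
  is "\<lambda>x y f z. f (x + z + y)"
proof -
  fix x y :: 'a and f :: "'a \<Rightarrow> complex"
  assume f: "f \<in> bcontfun"
  have "continuous_on UNIV (\<lambda>z. f (x + z + y))"
    by (rule continuous_on_compose2[of UNIV f])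
      (use f in \<open>auto simp: bcontfun_def intro!: continuous_intros\<close>)
  moreover have "bounded (range (\<lambda>z. f (x + z + y)))"
    by (rule bounded_subset[of "range f"]) (use f in \<open>auto simp: bcontfun_def\<close>)
  ultimately show "(\<lambda>z. f (x + z + y)) \<in> bcontfun"
    by (simp add: bcontfun_def)
qed

end

definition left_orbit :: "('a::topological_group_add \<Rightarrow>\<^sub>C complex) \<Rightarrow> ('a \<Rightarrow>\<^sub>C complex) set" where
  "left_orbit f = range (\<lambda>x. left_translate x f)"

definition orbit :: "('a::topological_group_add \<Rightarrow>\<^sub>C complex) \<Rightarrow> ('a \<Rightarrow>\<^sub>C complex) set" where
  "orbit f = {two_sided_translate x y f | x y. True}"

text \<open>
  The library provides only real scalar multiplication on \<open>'a \<Rightarrow>\<^sub>C complex\<close>, so complex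
  homogeneity of a functional is stated through the pointwise relation \<open>g = c f\<close>.
\<close>

definition complex_functional :: "(('a::topological_space \<Rightarrow>\<^sub>C complex) \<Rightarrow> complex) \<Rightarrow> bool" where
  "complex_functional \<phi> \<longleftrightarrow> bounded_linear \<phi> \<and>
     (\<forall>c f g. (\<forall>z. apply_bcontfun g z = c * apply_bcontfun f z) \<longrightarrow> \<phi> g = c * \<phi> f)"

definition weak_topology :: "('a::topological_space \<Rightarrow>\<^sub>C complex) topology" where
  "weak_topology = topology_generated_by {\<phi> -` U | \<phi> U. complex_functional \<phi> \<and> open U}"

definition AP :: "('a::topological_group_add \<Rightarrow>\<^sub>C complex) set" where
  "AP = {f. compact (closure (left_orbit f))}"

definition WS :: "('a::topological_group_add \<Rightarrow>\<^sub>C complex) set" where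
  "WS = {f. compactin weak_topology (weak_topology closure_of orbit f)}"

end

theory Submission
  imports Defs
begin

text \<open>
  Why \<open>AP \<subseteq> WS\<close>: if finitely many left translates of \<open>f\<close> approximate all of them, then the
  same holds for the two-sided translates (\<open>AP_imp_totally_bounded_orbit\<close>), so the orbit of \<open>f\<close>
  is relatively norm compact and therefore relatively weakly compact.

  Why the inclusion is strict: it suffices to find a central function \<open>F\<close>, that is
  \<open>F (x + y) = F (y + x)\<close>, which is uniformly continuous, does not vanish at \<open>0\<close>, and is a bump
  in the following sense: for a normal subgroup \<open>N\<close> such that \<open>G/N\<close> is not compact, \<open>F\<close> is
  constant on the cosets of \<open>N\<close> and vanishes off \<open>S + N\<close> for a compact \<open>S\<close>
  (\<open>central_bump_in_WS_minus_AP\<close>). By centrality the two-sided orbit is the left orbit. Translates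
  of \<open>F\<close> that are far apart have disjoint supports, so signed sums of them are no larger than \<open>F\<close>,
  and a bounded functional can be large on only few of them. Hence the translates tend
  weakly to \<open>0\<close> at infinity, while those over a compact set form a norm compact set: the orbit
  together with \<open>0\<close> is weakly compact. No norm compact set contains the orbit, because
  translates with disjoint supports have distance at least \<open>\<bar>F 0\<bar>\<close>.

  For a nilpotent group, let \<open>Z\<^sub>k\<close> be the terms of the upper central series. The quotient by \<open>Z\<^sub>0\<close>
  is not compact and the last quotient is trivial, so for some \<open>k\<close> the quotient \<open>G/Z\<^sub>k\<close> is not
  compact but \<open>G/Z\<close> is, where \<open>Z\<close> is the next term. Take a bump \<open>u\<close> with compact support and put
  \<open>F x = Sup {u (g + x - g + n) | g n. n \<in> Z\<^sub>k}\<close>. Since \<open>Z\<close> is central modulo \<open>Z\<^sub>k\<close>, only \<open>g\<close> in a compact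
  set matter, and so \<open>F\<close> is again uniformly continuous and supported near \<open>Z\<^sub>k\<close>
  (\<open>central_extension_WS_minus_AP\<close>).

  For an IN-group with compact invariant neighbourhood \<open>K\<close> of \<open>0\<close>, take \<open>N = {0}\<close> and let \<open>F x\<close> be the
  Haar measure of \<open>K \<inter> (x + K)\<close>. Only a small part of Haar measure theory is needed and developed here:
  a left invariant positive functional on the nonnegative continuous functions with compact support
  exists, as a limit of Weil's normalized covering indices (\<open>left_Haar_exists\<close>), it is unique
  up to a factor (\<open>left_Haar_unique\<close>), and the outer content of compact sets that it induces is modular
  and outer regular. Modularity and outer regularity make \<open>F\<close> continuous. Uniqueness implies
  that conjugation multiplies the content by a constant, and this constant is \<open>1\<close> because \<open>K\<close>
  is invariant and has positive content; so \<open>F\<close> is central (\<open>IN_WS_minus_AP\<close>).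
\<close>
section \<open>The weak topology of the space of bounded continuous functions\<close>

declare left_translate.rep_eq [simp] two_sided_translate.rep_eq [simp]

lemma norm_left_translate: "norm (left_translate x f) = norm f"
proof (rule antisym)
  show "norm (left_translate x f) \<le> norm f"
    by (rule norm_bound) (simp add: norm_bounded)
  show "norm f \<le> norm (left_translate x f)"
  proof (rule norm_bound)
    fix z
    have "norm (apply_bcontfun f z) = norm (apply_bcontfun (left_translate x f) (- x + z))"
      by (simp add: add.assoc[symmetric])
    then show "norm (apply_bcontfun f z) \<le> norm (left_translate x f)"
      by (simp only: norm_bounded)
  qed
qed

lemma bounded_linear_apply_bcontfun: "bounded_linear (\<lambda>f. apply_bcontfun f z)"
  by (rule bounded_linear_intro[where K = 1]) (simp_all add: norm_bounded)

lemma complex_functional_point_evaluation: "complex_functional (\<lambda>f. apply_bcontfun f z)"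
  unfolding complex_functional_def using bounded_linear_apply_bcontfun by blast

lemma topspace_weak_topology [simp]: "topspace weak_topology = UNIV"
proof -
  have "complex_functional (\<lambda>f :: 'a \<Rightarrow>\<^sub>C complex. 0)"
    by (auto simp: complex_functional_def)
  then have "(UNIV :: ('a \<Rightarrow>\<^sub>C complex) set) \<in> {\<phi> -` U | \<phi> U. complex_functional \<phi> \<and> open U}"
    by (intro CollectI exI[of _ "\<lambda>_. 0"] exI[of _ UNIV]) auto
  then show ?thesis
    unfolding weak_topology_def topology_generated_by_topspace by blast
qed

lemma openin_weak_topology_vimage:
  "complex_functional \<phi> \<Longrightarrow> open U \<Longrightarrow> openin weak_topology (\<phi> -` U)"
  unfolding weak_topology_def by (rule topology_generated_by_Basis) auto

lemma openin_weak_topology_imp_open: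
  assumes "openin weak_topology W"
  shows "open W"
proof -
  have "generate_topology_on {\<phi> -` U | \<phi> U. complex_functional \<phi> \<and> open U} W"
    using assms unfolding weak_topology_def by (rule openin_topology_generated_by)
  then show ?thesis
  proof induction
    case (Basis s)
    then show ?case
      by (auto simp: complex_functional_def intro!: open_vimage linear_continuous_on)
  qed auto
qed

lemma Hausdorff_weak_topology: "Hausdorff_space (weak_topology :: ('a::topological_space \<Rightarrow>\<^sub>C complex) topology)"
  unfolding Hausdorff_space_def
proof (intro allI impI)
  fix f g :: "'a \<Rightarrow>\<^sub>C complex"
  assume "f \<in> topspace weak_topology \<and> g \<in> topspace weak_topology \<and> f \<noteq> g"
  then obtain z where z: "apply_bcontfun f z \<noteq> apply_bcontfun g z"
    using bcontfun_eqI by blast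
  then obtain U V where UV: "open U" "open V" "apply_bcontfun f z \<in> U" "apply_bcontfun g z \<in> V" "U \<inter> V = {}"
    by (metis hausdorff)
  let ?e = "\<lambda>f :: 'a \<Rightarrow>\<^sub>C complex. apply_bcontfun f z"
  have "openin weak_topology (?e -` U)" "openin weak_topology (?e -` V)"
    using UV by (auto intro: openin_weak_topology_vimage complex_functional_point_evaluation)
  moreover have "disjnt (?e -` U) (?e -` V)" using UV(5) by (auto simp: disjnt_def)
  ultimately show "\<exists>U V. openin weak_topology U \<and> openin weak_topology V \<and> f \<in> U \<and> g \<in> V \<and> disjnt U V"
    using UV by (intro exI[of _ "?e -` U"] exI[of _ "?e -` V"]) auto
qed

lemma compact_imp_compactin_weak_topology:
  assumes "compact K"
  shows "compactin weak_topology K"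
proof -
  have "continuous_map euclidean weak_topology id"
    by (auto simp: continuous_map_def openin_weak_topology_imp_open)
  from image_compactin[OF _ this, of K] assms show ?thesis by simp
qed

text \<open>
  The weak topology is Hausdorff, so a weakly compact set is weakly closed and contains the
  weak closure of each of its subsets.
\<close>

lemma orbit_subset_weakly_compact_imp_WS:
  assumes "compactin weak_topology K" "orbit f \<subseteq> K"
  shows "f \<in> WS"
proof -
  have "closedin weak_topology K"
    using assms(1) Hausdorff_weak_topology compactin_imp_closedin by blast
  then have "weak_topology closure_of orbit f \<subseteq> K"
    using assms(2) by (simp add: closure_of_minimal)
  then show ?thesis
    unfolding WS_def using assms(1) closed_compactin closedin_closure_of by blast
qed

text \<open>
  Finitely many bounded functions map into a totally bounded subset of a product of finitely many
  planes; sorting the arguments by the cells of a finite cover of that set gives the net.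
\<close>

lemma finite_net_of_values:
  fixes h :: "'b \<Rightarrow> 'c \<Rightarrow> complex"
  assumes "finite X" "\<And>a. a \<in> X \<Longrightarrow> bounded (range (h a))" "0 < d"
  shows "\<exists>Y. finite Y \<and> (\<forall>y. \<exists>b\<in>Y. \<forall>a\<in>X. dist (h a y) (h a b) < d)"
proof -
  have "\<forall>a\<in>X. \<exists>k. finite k \<and> range (h a) \<subseteq> (\<Union>w\<in>k. ball w (d/2))"
  proof
    fix a assume "a \<in> X"
    then have "compact (closure (range (h a)))"
      using assms(2) by simp
    then obtain k where "finite k" "closure (range (h a)) \<subseteq> (\<Union>w\<in>k. ball w (d/2))"
      using assms(3) unfolding compact_eq_totally_bounded by (metis half_gt_zero)
    then show "\<exists>k. finite k \<and> range (h a) \<subseteq> (\<Union>w\<in>k. ball w (d/2))"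
      by (meson closure_subset subset_trans)
  qed
  then obtain k where k: "\<And>a. a \<in> X \<Longrightarrow> finite (k a)"
    "\<And>a. a \<in> X \<Longrightarrow> range (h a) \<subseteq> (\<Union>w\<in>k a. ball w (d/2))"
    by metis
  have "\<exists>w\<in>k a. dist w (h a y) < d/2" if "a \<in> X" for a y
    using k(2)[OF that] by fastforce
  then obtain c where c: "\<And>a y. a \<in> X \<Longrightarrow> c a y \<in> k a \<and> dist (c a y) (h a y) < d/2"
    by metis
  define q where "q = (\<lambda>y. restrict (\<lambda>a. c a y) X)"
  have "range q \<subseteq> PiE X k"
    using c by (auto simp: q_def)
  then have fin: "finite (range q)"
    using finite_PiE[OF assms(1), of k] k(1) finite_subset by blast
  have "\<exists>b\<in>inv q ` range q. \<forall>a\<in>X. dist (h a y) (h a b) < d" for y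
  proof (intro bexI ballI)
    fix a assume a: "a \<in> X"
    define b where "b = inv q (q y)"
    have "q b = q y" by (simp add: b_def f_inv_into_f)
    then have "c a b = c a y" using a unfolding q_def by (metis restrict_apply')
    then have "dist (c a y) (h a b) < d/2" using c[OF a, of b] by simp
    with c[OF a, of y] show "dist (h a y) (h a (inv q (q y))) < d"
      unfolding b_def[symmetric] by (metis dist_commute dist_triangle_half_r)
  qed auto
  then show ?thesis using fin by blast
qed

text \<open>
  Uniform limits of bounded continuous functions are bounded and continuous over every topological
  space; a locally compact group may fail to be metrizable.
\<close>

lemma complete_UNIV_bcontfun:
  "complete (UNIV :: ('a::topological_space \<Rightarrow>\<^sub>C 'b::complete_space) set)"
proof (rule completeI)
  fix f :: "nat \<Rightarrow> 'a \<Rightarrow>\<^sub>C 'b"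
  assume "Cauchy f"
  then have "uniformly_Cauchy_on UNIV (\<lambda>n. apply_bcontfun (f n))"
    unfolding Cauchy_def uniformly_Cauchy_on_def by (metis dist_fun_lt_imp_dist_val_lt)
  then have "uniformly_convergent_on UNIV (\<lambda>n. apply_bcontfun (f n))"
    by (rule Cauchy_uniformly_convergent)
  then obtain g where "uniform_limit UNIV (\<lambda>n. apply_bcontfun (f n)) g sequentially"
    by (auto simp: uniformly_convergent_on_def)
  from uniform_limit_bcontfunE[OF this sequentially_bot]
  show "\<exists>l\<in>UNIV. f \<longlonglongrightarrow> l" by (metis UNIV_I)
qed

text \<open>
  Total boundedness passes from the left orbit to the two-sided orbit: if the translates by
  \<open>x\<^sub>1, \<dots>, x\<^sub>n\<close> form a net of the left orbit, then a point \<open>y\<close> acts on the right almost as the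
  vector \<open>(f (x\<^sub>1 + y), \<dots>, f (x\<^sub>n + y))\<close> prescribes, and these vectors form a bounded set in
  a finite-dimensional space.
\<close>

lemma AP_imp_totally_bounded_orbit:
  fixes f :: "'a::topological_group_add \<Rightarrow>\<^sub>C complex"
  assumes "f \<in> AP" "0 < e"
  shows "\<exists>k. finite k \<and> orbit f \<subseteq> (\<Union>g\<in>k. ball g e)"
proof -
  define d where "d = e / 5"
  have d: "0 < d" using assms by (simp add: d_def)
  from assms have "compact (closure (left_orbit f))" by (simp add: AP_def)
  then obtain k0 where k0: "finite k0" "k0 \<subseteq> closure (left_orbit f)" "closure (left_orbit f) \<subseteq> (\<Union>g\<in>k0. ball g (d/2))"
    using compactE_image[of "closure (left_orbit f)" "closure (left_orbit f)" "\<lambda>g. ball g (d/2)"] d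
    by (force simp del: closure_eq)
  have "\<forall>g\<in>k0. \<exists>x. dist g (left_translate x f) < d/2"
  proof
    fix g assume "g \<in> k0"
    with k0 have "g \<in> closure (left_orbit f)" by blast
    then obtain h where "h \<in> left_orbit f" "dist h g < d/2"
      using d unfolding closure_approachable by (metis half_gt_zero)
    then show "\<exists>x. dist g (left_translate x f) < d/2"
      by (auto simp: left_orbit_def dist_commute)
  qed
  then obtain s where s: "\<And>g. g \<in> k0 \<Longrightarrow> dist g (left_translate (s g) f) < d/2" by metis
  define X where "X = s ` k0"
  have X: "finite X" using k0 by (simp add: X_def)
  \<comment> \<open>The centres of the balls are now translates by the points of the finite set \<open>X\<close>.\<close>
  have net: "\<exists>a\<in>X. \<forall>z. dist (apply_bcontfun f (x + z)) (apply_bcontfun f (a + z)) < d" for x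
  proof -
    have "left_translate x f \<in> closure (left_orbit f)"
      using closure_subset[of "left_orbit f"] by (auto simp: left_orbit_def)
    with k0 obtain g where g: "g \<in> k0" "dist g (left_translate x f) < d/2" by auto
    have "dist (left_translate x f) (left_translate (s g) f) < d"
      using dist_triangle_half_l[OF g(2)[unfolded dist_commute[of g]] s[OF g(1), unfolded dist_commute[of g]]]
      by (simp add: dist_commute)
    then have "dist (apply_bcontfun f (x + z)) (apply_bcontfun f (s g + z)) < d" for z
      using dist_fun_lt_imp_dist_val_lt[of "left_translate x f" "left_translate (s g) f" d z] by simp
    then show ?thesis using g(1) by (auto simp: X_def)
  qed
  have bdd: "bounded (range (\<lambda>y. apply_bcontfun f (a + y)))" for a
    by (rule bounded_subset[OF bounded_apply_bcontfun[of f]]) auto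
  obtain Y where Y: "finite Y" "\<And>y. \<exists>b\<in>Y. \<forall>a\<in>X. dist (apply_bcontfun f (a + y)) (apply_bcontfun f (a + b)) < d"
    using finite_net_of_values[of X "\<lambda>a y. apply_bcontfun f (a + y)" d] X d bdd by blast
  define k where "k = (\<lambda>(a, b). two_sided_translate a b f) ` (X \<times> Y)"
  have "finite k" using X Y by (simp add: k_def)
  moreover have "orbit f \<subseteq> (\<Union>g\<in>k. ball g e)"
  proof
    fix g assume "g \<in> orbit f"
    then obtain x y where g: "g = two_sided_translate x y f" by (auto simp: orbit_def)
    obtain a where a: "a \<in> X" "\<And>z. dist (apply_bcontfun f (x + z)) (apply_bcontfun f (a + z)) < d"
      using net by blast
    obtain b where b: "b \<in> Y" "\<And>a. a \<in> X \<Longrightarrow> dist (apply_bcontfun f (a + y)) (apply_bcontfun f (a + b)) < d"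
      using Y by blast
    have "dist (apply_bcontfun f (x + z + y)) (apply_bcontfun f (a + z + b)) \<le> 4 * d" for z
    proof -
      obtain a' where a': "a' \<in> X" "\<And>u. dist (apply_bcontfun f ((a + z) + u)) (apply_bcontfun f (a' + u)) < d"
        using net by blast
      have "dist (apply_bcontfun f (x + z + y)) (apply_bcontfun f (a + z + y)) < d"
        using a(2)[of "z + y"] by (simp add: add.assoc)
      moreover have "dist (apply_bcontfun f (a + z + y)) (apply_bcontfun f (a' + y)) < d"
        using a'(2)[of y] .
      moreover have "dist (apply_bcontfun f (a' + y)) (apply_bcontfun f (a' + b)) < d"
        using b(2)[OF a'(1)] .
      moreover have "dist (apply_bcontfun f (a + z + b)) (apply_bcontfun f (a' + b)) < d"
        using a'(2)[of b] .
      ultimately show ?thesis by metric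
    qed
    then have "dist g (two_sided_translate a b f) \<le> 4 * d"
      unfolding g by (intro dist_bound) simp
    also have "\<dots> < e" using assms(2) by (simp add: d_def)
    finally have "g \<in> ball (two_sided_translate a b f) e" by (simp add: dist_commute)
    moreover have "two_sided_translate a b f \<in> k" using a b by (force simp: k_def)
    ultimately show "g \<in> (\<Union>g\<in>k. ball g e)" by blast
  qed
  ultimately show ?thesis by blast
qed

lemma AP_subset_WS: "(AP :: ('a::topological_group_add \<Rightarrow>\<^sub>C complex) set) \<subseteq> WS"
proof
  fix f :: "'a \<Rightarrow>\<^sub>C complex" assume f: "f \<in> AP"
  have "\<exists>k. finite k \<and> closure (orbit f) \<subseteq> (\<Union>g\<in>k. ball g e)" if e: "0 < e" for e
  proof -
    obtain k where k: "finite k" "orbit f \<subseteq> (\<Union>g\<in>k. ball g (e/2))"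
      using AP_imp_totally_bounded_orbit[OF f, of "e/2"] e by auto
    then have "closure (orbit f) \<subseteq> (\<Union>g\<in>k. cball g (e/2))"
      by (intro closure_minimal closed_UN) (auto intro: less_imp_le simp: subset_iff)
    also have "\<dots> \<subseteq> (\<Union>g\<in>k. ball g e)" using e by auto
    finally show ?thesis using k(1) by blast
  qed
  then have "compact (closure (orbit f))"
    using complete_closed_subset[OF closed_closure subset_UNIV complete_UNIV_bcontfun]
    by (simp add: compact_eq_totally_bounded)
  then show "f \<in> WS"
    by (intro orbit_subset_weakly_compact_imp_WS[of "closure (orbit f)"])
      (auto simp: compact_imp_compactin_weak_topology closure_subset)
qed

section \<open>Central functions with sparse orbits\<close>

lemma compact_sum_set:
  fixes S T :: "'a::topological_group_add set"
  assumes "compact S" "compact T"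
  shows "compact {s + t | s t. s \<in> S \<and> t \<in> T}"
proof -
  have "compact ((\<lambda>p. fst p + snd p) ` (S \<times> T))"
    by (intro compact_continuous_image compact_Times assms continuous_intros)
  also have "(\<lambda>p. fst p + snd p) ` (S \<times> T) = {s + t | s t. s \<in> S \<and> t \<in> T}"
    by force
  finally show ?thesis .
qed

lemma compact_uminus_set:
  fixes S :: "'a::topological_group_add set"
  assumes "compact S"
  shows "compact (uminus ` S)"
  by (intro compact_continuous_image assms continuous_intros)

text \<open>
  At each point at most one summand is nonzero.
\<close>

lemma norm_sum_disjoint_supports:
  fixes h :: "'i \<Rightarrow> ('a::topological_space \<Rightarrow>\<^sub>C complex)"
  assumes "finite P" "0 \<le> B" "\<And>p. p \<in> P \<Longrightarrow> norm (h p) \<le> B"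
    and disj: "\<And>p q z. p \<in> P \<Longrightarrow> q \<in> P \<Longrightarrow> apply_bcontfun (h p) z \<noteq> 0 \<Longrightarrow> apply_bcontfun (h q) z \<noteq> 0 \<Longrightarrow> p = q"
  shows "norm (\<Sum>p\<in>P. h p) \<le> B"
proof (rule norm_bound)
  fix z
  have eq: "apply_bcontfun (\<Sum>p\<in>P. h p) z = (\<Sum>p\<in>P. apply_bcontfun (h p) z)"
    by (rule linear_sum[OF bounded_linear.linear[OF bounded_linear_apply_bcontfun]])
  show "norm (apply_bcontfun (\<Sum>p\<in>P. h p) z) \<le> B"
  proof (cases "\<exists>p\<in>P. apply_bcontfun (h p) z \<noteq> 0")
    case True
    then obtain p where p: "p \<in> P" "apply_bcontfun (h p) z \<noteq> 0" by blast
    have "(\<Sum>q\<in>P. apply_bcontfun (h q) z) = (\<Sum>q\<in>{p}. apply_bcontfun (h q) z)"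
      by (rule sum.mono_neutral_right) (use assms(1) p disj in auto)
    then show ?thesis
      using eq norm_bounded[of "h p" z] assms(3)[OF p(1)] by simp
  next
    case False
    then show ?thesis using eq assms(2) by simp
  qed
qed

definition supports_meet :: "('a::topological_group_add \<Rightarrow>\<^sub>C complex) \<Rightarrow> 'a \<Rightarrow> 'a \<Rightarrow> bool" where
  "supports_meet f x y \<longleftrightarrow> (\<exists>z. apply_bcontfun f (x + z) \<noteq> 0 \<and> apply_bcontfun f (y + z) \<noteq> 0)"

lemma supports_meet_sym: "supports_meet f x y \<Longrightarrow> supports_meet f y x"
  by (auto simp: supports_meet_def)

text \<open>
  A translate whose support meets that of a given one is determined by a parameter from a compact
  set. The parameter need not be \<open>x\<close> itself, so functions that are constant on the cosets of a
  noncompact subgroup are included.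
\<close>

definition sparse_orbit :: "('a::topological_group_add \<Rightarrow>\<^sub>C complex) \<Rightarrow> bool" where
  "sparse_orbit f \<longleftrightarrow> (\<forall>y. \<exists>C. compact C \<and>
     (\<forall>x. supports_meet f x y \<longrightarrow> left_translate x f \<in> (\<lambda>c. left_translate c f) ` C))"

text \<open>
  Apply \<open>\<psi>\<close> to the sum of the translates with the signs of their values under \<open>\<psi>\<close>: the result is at
  least \<open>e\<close> for each translate, whereas the norm of the sum does not grow.
\<close>

lemma card_disjoint_translates_le:
  fixes \<psi> :: "('a::topological_group_add \<Rightarrow>\<^sub>C complex) \<Rightarrow> real"
  assumes "bounded_linear \<psi>" "finite P"
    and large: "\<And>p. p \<in> P \<Longrightarrow> e \<le> \<bar>\<psi> (left_translate p f)\<bar>"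
    and disj: "\<And>p q. p \<in> P \<Longrightarrow> q \<in> P \<Longrightarrow> supports_meet f p q \<Longrightarrow> p = q"
  shows "real (card P) * e \<le> onorm \<psi> * norm f"
proof -
  interpret bounded_linear \<psi> by fact
  define h where "h = (\<lambda>p. sgn (\<psi> (left_translate p f)) *\<^sub>R left_translate p f)"
  have "real (card P) * e \<le> (\<Sum>p\<in>P. \<bar>\<psi> (left_translate p f)\<bar>)"
    using sum_bounded_below[of P e "\<lambda>p. \<bar>\<psi> (left_translate p f)\<bar>"] large by simp
  also have "\<dots> = \<psi> (\<Sum>p\<in>P. h p)"
    by (simp add: sum h_def scaleR abs_sgn mult.commute)
  also have "\<dots> \<le> norm (\<psi> (\<Sum>p\<in>P. h p))" by simp
  also have "\<dots> \<le> onorm \<psi> * norm (\<Sum>p\<in>P. h p)"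
    by (rule onorm) fact
  also have "\<dots> \<le> onorm \<psi> * norm f"
  proof (intro mult_left_mono norm_sum_disjoint_supports assms(2))
    show "norm (h p) \<le> norm f" if "p \<in> P" for p
      by (simp add: h_def norm_left_translate sgn_if)
    show "p = q" if "p \<in> P" "q \<in> P" "apply_bcontfun (h p) z \<noteq> 0" "apply_bcontfun (h q) z \<noteq> 0" for p q z
      using that disj[of p q] by (auto simp: h_def supports_meet_def)
  qed (simp_all add: onorm_pos_le assms(1))
  finally show ?thesis .
qed

text \<open>
  A family of translates on which \<open>\<psi>\<close> is at least \<open>e\<close> and whose supports are pairwise disjoint has
  bounded size. For a family of maximal size, every further such translate has a support that meets
  one of the finitely many supports in the family.
\<close>

lemma functional_small_off_compact:
  fixes \<psi> :: "('a::topological_group_add \<Rightarrow>\<^sub>C complex) \<Rightarrow> real"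
  assumes "bounded_linear \<psi>" "sparse_orbit f" "0 < e"
  shows "\<exists>C. compact C \<and> (\<forall>x. e \<le> \<bar>\<psi> (left_translate x f)\<bar> \<longrightarrow> left_translate x f \<in> (\<lambda>c. left_translate c f) ` C)"
proof -
  define good where "good = (\<lambda>P. finite P \<and> (\<forall>p\<in>P. e \<le> \<bar>\<psi> (left_translate p f)\<bar>) \<and>
      (\<forall>p\<in>P. \<forall>q\<in>P. supports_meet f p q \<longrightarrow> p = q))"
  obtain b :: nat where b: "onorm \<psi> * norm f / e < b" using reals_Archimedean2 by blast
  have bound: "card P < b" if "good P" for P
  proof -
    have "real (card P) * e \<le> onorm \<psi> * norm f"
      by (rule card_disjoint_translates_le[OF assms(1)]) (use that in \<open>auto simp: good_def\<close>)
    then have "card P \<le> onorm \<psi> * norm f / e" using assms(3) by (simp add: pos_le_divide_eq)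
    with b show ?thesis by linarith
  qed
  have "good {}" by (simp add: good_def)
  from ex_has_greatest_nat[of good, OF this, of card b] bound
  obtain P where P: "good P" and max: "\<And>Q. good Q \<Longrightarrow> card Q \<le> card P" by blast
  obtain C where C: "\<And>y. compact (C y)"
    "\<And>x y. supports_meet f x y \<Longrightarrow> left_translate x f \<in> (\<lambda>c. left_translate c f) ` C y"
    using assms(2) unfolding sparse_orbit_def by metis
  have finP: "finite P" using P by (simp add: good_def)
  have "compact (P \<union> (\<Union>p\<in>P. C p))"
    by (intro compact_Un finite_imp_compact[OF finP] compact_UN[OF finP] ballI C(1))
  moreover have "left_translate x f \<in> (\<lambda>c. left_translate c f) ` (P \<union> (\<Union>p\<in>P. C p))"
    if x: "e \<le> \<bar>\<psi> (left_translate x f)\<bar>" for x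
  proof (cases "x \<in> P \<or> (\<exists>p\<in>P. supports_meet f x p)")
    case True
    then show ?thesis using C(2) by blast
  next
    case False
    then have "good (insert x P)"
      using P x supports_meet_sym[of f] unfolding good_def by blast
    from max[OF this] False finP show ?thesis by simp
  qed
  ultimately show ?thesis by blast
qed

text \<open>
  The left translates tend weakly to \<open>0\<close> at infinity.
\<close>

lemma weak_nhd_of_zero_off_compact:
  fixes f :: "'a::topological_group_add \<Rightarrow>\<^sub>C complex"
  assumes "sparse_orbit f" "openin weak_topology W" "0 \<in> W"
  shows "\<exists>C. compact C \<and> (\<forall>x. left_translate x f \<in> W \<or> left_translate x f \<in> (\<lambda>c. left_translate c f) ` C)"
proof -
  have "generate_topology_on {\<phi> -` U | \<phi> U. complex_functional \<phi> \<and> open U} W"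
    using assms(2) unfolding weak_topology_def by (rule openin_topology_generated_by)
  then show ?thesis using assms(3)
  proof induction
    case (Int A B)
    from Int.IH(1) Int.prems obtain C where C: "compact C"
      "\<And>x. left_translate x f \<in> A \<or> left_translate x f \<in> (\<lambda>c. left_translate c f) ` C" by blast
    from Int.IH(2) Int.prems obtain D where D: "compact D"
      "\<And>x. left_translate x f \<in> B \<or> left_translate x f \<in> (\<lambda>c. left_translate c f) ` D" by blast
    have "left_translate x f \<in> A \<inter> B \<or> left_translate x f \<in> (\<lambda>c. left_translate c f) ` (C \<union> D)" for x
      using C(2)[of x] D(2)[of x] by blast
    then show ?case using compact_Un[OF C(1) D(1)] by blast
  next
    case (UN K)
    then obtain k where k: "k \<in> K" "0 \<in> k" by blast
    with UN.IH[OF k(1) k(2)] show ?case by blast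
  next
    case (Basis s)
    then obtain \<phi> U where \<phi>: "complex_functional \<phi>" and U: "open U" "s = \<phi> -` U" by blast
    have bl: "bounded_linear \<phi>" using \<phi> by (simp add: complex_functional_def)
    have "0 \<in> U" using Basis(2) U linear_0[OF bounded_linear.linear[OF bl]] by simp
    then obtain e where e: "0 < e" "ball 0 e \<subseteq> U" using U(1) openE by blast
    obtain C where C: "compact C"
      "\<And>x. e/2 \<le> \<bar>Re (\<phi> (left_translate x f))\<bar> \<Longrightarrow> left_translate x f \<in> (\<lambda>c. left_translate c f) ` C"
      using functional_small_off_compact[OF bounded_linear_compose[OF bounded_linear_Re bl] assms(1), of "e/2"] e
      by auto
    obtain D where D: "compact D"
      "\<And>x. e/2 \<le> \<bar>Im (\<phi> (left_translate x f))\<bar> \<Longrightarrow> left_translate x f \<in> (\<lambda>c. left_translate c f) ` D"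
      using functional_small_off_compact[OF bounded_linear_compose[OF bounded_linear_Im bl] assms(1), of "e/2"] e
      by auto
    have "left_translate x f \<in> s \<or> left_translate x f \<in> (\<lambda>c. left_translate c f) ` (C \<union> D)" for x
    proof (rule ccontr)
      assume neg: "\<not> ?thesis"
      then have "\<bar>Re (\<phi> (left_translate x f))\<bar> < e/2" "\<bar>Im (\<phi> (left_translate x f))\<bar> < e/2"
        using C(2)[of x] D(2)[of x] by (auto simp: not_le[symmetric])
      then have "norm (\<phi> (left_translate x f)) < e"
        using cmod_le[of "\<phi> (left_translate x f)"] by linarith
      then have "\<phi> (left_translate x f) \<in> ball 0 e" by simp
      then have "left_translate x f \<in> s" using e U by blast
      with neg show False by blast
    qed
    then show ?case using compact_Un[OF C(1) D(1)] by blast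
  qed auto
qed

text \<open>
  The left orbit together with \<open>0\<close> is weakly compact: in an open cover, a member that contains \<open>0\<close>
  leaves over only translates by a compact set, and these form a norm compact set.
\<close>

lemma sparse_central_imp_WS:
  fixes f :: "'a::topological_group_add \<Rightarrow>\<^sub>C complex"
  assumes central: "\<And>x y. apply_bcontfun f (x + y) = apply_bcontfun f (y + x)"
    and cont: "continuous_on UNIV (\<lambda>x. left_translate x f)"
    and sparse: "sparse_orbit f"
  shows "f \<in> WS"
proof (rule orbit_subset_weakly_compact_imp_WS)
  show "orbit f \<subseteq> insert 0 (left_orbit f)"
  proof
    fix g assume "g \<in> orbit f"
    then obtain x y where g: "g = two_sided_translate x y f" by (auto simp: orbit_def)
    have "g = left_translate (y + x) f"
    proof (rule bcontfun_eqI)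
      show "apply_bcontfun g z = apply_bcontfun (left_translate (y + x) f) z" for z
        using central[of "x + z" y] by (simp add: g add.assoc)
    qed
    then show "g \<in> insert 0 (left_orbit f)" by (simp add: left_orbit_def)
  qed
  show "compactin weak_topology (insert 0 (left_orbit f))"
    unfolding compactin_def
  proof (intro conjI allI impI)
    fix \<U> assume \<U>: "Ball \<U> (openin weak_topology) \<and> insert 0 (left_orbit f) \<subseteq> \<Union> \<U>"
    then obtain W where W: "W \<in> \<U>" "0 \<in> W" "openin weak_topology W" by blast
    obtain C where C: "compact C" "\<And>x. left_translate x f \<in> W \<or> left_translate x f \<in> (\<lambda>c. left_translate c f) ` C"
      using weak_nhd_of_zero_off_compact[OF sparse W(3,2)] by blast
    have "compactin weak_topology ((\<lambda>c. left_translate c f) ` C)"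
      using compact_continuous_image[OF continuous_on_subset[OF cont] C(1)]
      by (intro compact_imp_compactin_weak_topology) simp
    moreover have "(\<lambda>c. left_translate c f) ` C \<subseteq> \<Union> \<U>"
      using \<U> by (auto simp: left_orbit_def)
    ultimately obtain \<F> where "finite \<F>" "\<F> \<subseteq> \<U>" "(\<lambda>c. left_translate c f) ` C \<subseteq> \<Union> \<F>"
      using \<U> unfolding compactin_def by meson
    moreover have "insert 0 (left_orbit f) \<subseteq> \<Union> (insert W \<F>)"
      if "(\<lambda>c. left_translate c f) ` C \<subseteq> \<Union> \<F>"
    proof -
      have "left_translate x f \<in> \<Union> (insert W \<F>)" for x
        using C(2)[of x] that by blast
      then show ?thesis using W(2) by (auto simp: left_orbit_def)
    qed
    ultimately show "\<exists>\<F>. finite \<F> \<and> \<F> \<subseteq> \<U> \<and> insert 0 (left_orbit f) \<subseteq> \<Union> \<F>"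
      using W(1) by (intro exI[of _ "insert W \<F>"]) simp
  qed simp
qed

text \<open>
  A finite net of the left orbit would leave room for a translate whose support is disjoint from
  the supports of all members of the net, and its distance to them is at least \<open>\<bar>f 0\<bar>\<close>.
\<close>

lemma sparse_imp_not_AP:
  fixes f :: "'a::topological_group_add \<Rightarrow>\<^sub>C complex"
  assumes sparse: "sparse_orbit f" and nz: "apply_bcontfun f 0 \<noteq> 0"
    and noncompact: "\<And>C. compact C \<Longrightarrow> \<exists>x. left_translate x f \<notin> (\<lambda>c. left_translate c f) ` C"
  shows "f \<notin> AP"
proof
  assume "f \<in> AP"
  then have cpt: "compact (closure (left_orbit f))" by (simp add: AP_def)
  define d where "d = norm (apply_bcontfun f 0)"
  have d: "0 < d" using nz by (simp add: d_def)
  have "left_orbit f \<subseteq> closure (left_orbit f)" by (rule closure_subset)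
  have "closure (left_orbit f) \<subseteq> (\<Union>g\<in>left_orbit f. ball g d)"
  proof
    fix h assume "h \<in> closure (left_orbit f)"
    then obtain g where "g \<in> left_orbit f" "dist g h < d"
      using d unfolding closure_approachable by blast
    then show "h \<in> (\<Union>g\<in>left_orbit f. ball g d)" by auto
  qed
  then obtain k where k: "k \<subseteq> left_orbit f" "finite k" "closure (left_orbit f) \<subseteq> (\<Union>g\<in>k. ball g d)"
    using compactE_image[OF cpt, of "left_orbit f" "\<lambda>g. ball g d"] by auto
  obtain P where P: "finite P" "k = (\<lambda>p. left_translate p f) ` P"
    using k(1,2) unfolding left_orbit_def by (meson finite_subset_image)
  obtain C where C: "\<And>y. compact (C y)"
    "\<And>x y. supports_meet f x y \<Longrightarrow> left_translate x f \<in> (\<lambda>c. left_translate c f) ` C y"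
    using sparse unfolding sparse_orbit_def by metis
  obtain x where x: "left_translate x f \<notin> (\<lambda>c. left_translate c f) ` (\<Union>p\<in>P. C p)"
    using noncompact[of "\<Union>p\<in>P. C p"] C(1) P(1) by (auto intro!: compact_UN)
  have "left_translate x f \<in> closure (left_orbit f)"
    using closure_subset[of "left_orbit f"] by (auto simp: left_orbit_def)
  with k(3) P(2) obtain p where p: "p \<in> P" "dist (left_translate p f) (left_translate x f) < d"
    by auto
  have "\<not> supports_meet f x p" using x C(2) p(1) by blast
  moreover have "supports_meet f x p" if "apply_bcontfun f (p + - x) \<noteq> 0"
    unfolding supports_meet_def using nz that by (intro exI[of _ "- x"]) simp
  ultimately have "apply_bcontfun f (p + - x) = 0" by blast
  then have "dist (apply_bcontfun (left_translate p f) (- x)) (apply_bcontfun (left_translate x f) (- x)) = d"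
    by (simp add: d_def)
  moreover have "dist (apply_bcontfun (left_translate p f) (- x)) (apply_bcontfun (left_translate x f) (- x))
      \<le> dist (left_translate p f) (left_translate x f)"
    by (rule dist_bounded)
  ultimately show False using p(2) by linarith
qed

section \<open>Central bump functions modulo a normal subgroup\<close>

text \<open>
  Rewriting to right-nested sums of elements and their inverses decides identities in a
  noncommutative additive group.
\<close>

lemmas group_normalize = diff_conv_add_uminus add.assoc minus_add minus_minus minus_zero
  add_0_left add_0_right left_minus right_minus minus_add_cancel add_minus_cancel

definition normal_subgroup_add :: "'a::group_add set \<Rightarrow> bool" where
  "normal_subgroup_add N \<longleftrightarrow> 0 \<in> N \<and> (\<forall>x\<in>N. \<forall>y\<in>N. x + y \<in> N) \<and> (\<forall>x\<in>N. - x \<in> N) \<and>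
     (\<forall>g. \<forall>x\<in>N. g + x - g \<in> N)"

lemma normal_subgroup_add_conj: "normal_subgroup_add N \<Longrightarrow> x \<in> N \<Longrightarrow> - g + x + g \<in> N"
  unfolding normal_subgroup_add_def by (metis diff_minus_eq_add)

lemma normal_subgroup_add_diff: "normal_subgroup_add N \<Longrightarrow> x \<in> N \<Longrightarrow> y \<in> N \<Longrightarrow> x + - y \<in> N"
  by (simp add: normal_subgroup_add_def del: add_uminus_conv_diff)

text \<open>
  For a normal subgroup of a locally compact group this says that the quotient is compact.
  It is stated without the quotient, and so it makes sense for subgroups that are not closed.
\<close>

definition cocompact :: "'a::topological_group_add set \<Rightarrow> bool" where
  "cocompact N \<longleftrightarrow> (\<exists>C. compact C \<and> (\<forall>x. \<exists>c\<in>C. \<exists>n\<in>N. x = c + n))"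

text \<open>
  One of the two uniform continuities of functions on a topological group: for bounded
  \<open>F\<close> it makes the left translate of \<open>F\<close> by \<open>x\<close> depend continuously on \<open>x\<close> in the supremum norm,
  because \<open>(x + z) - (y + z) = x - y\<close>.
\<close>

definition translation_continuous :: "('a::topological_group_add \<Rightarrow> 'b::metric_space) \<Rightarrow> bool" where
  "translation_continuous F \<longleftrightarrow>
     (\<forall>e>0. \<exists>V. open V \<and> 0 \<in> V \<and> (\<forall>x y. x - y \<in> V \<longrightarrow> dist (F x) (F y) < e))"

lemma translation_continuous_imp_continuous_on:
  assumes "translation_continuous F"
  shows "continuous_on UNIV F"
  unfolding continuous_on_def
proof (intro ballI tendstoI)
  fix x :: 'a and e :: real assume "0 < e"
  then obtain V where V: "open V" "0 \<in> V" "\<And>x y. x - y \<in> V \<Longrightarrow> dist (F x) (F y) < e"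
    using assms unfolding translation_continuous_def by blast
  have "open ((\<lambda>y. y - x) -` V)"
    by (intro open_vimage V(1) continuous_intros)
  then show "\<forall>\<^sub>F y in at x within UNIV. dist (F y) (F x) < e"
    unfolding eventually_at_topological using V by (intro exI[of _ "(\<lambda>y. y - x) -` V"]) auto
qed

lemma translation_continuous_compact_support:
  fixes u :: "'a::topological_group_add \<Rightarrow> real"
  assumes "continuous_on UNIV u" "compact S" "\<And>x. x \<notin> S \<Longrightarrow> u x = 0"
  shows "translation_continuous u"
  unfolding translation_continuous_def
proof (intro allI impI)
  fix e :: real assume e: "0 < e"
  define W where "W = (\<lambda>p. dist (u (fst p + snd p)) (u (snd p))) -` {..<e}"
  have "continuous_on UNIV (\<lambda>p :: 'a \<times> 'a. dist (u (fst p + snd p)) (u (snd p)))"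
    by (intro continuous_intros continuous_on_compose2[OF assms(1)]) auto
  then have W: "open W" unfolding W_def by (intro open_vimage) auto
  have "{0} \<times> S \<subseteq> W" using e by (auto simp: W_def)
  from Elementary_Topology.tube_lemma[OF assms(2) W this]
  obtain V where V: "0 \<in> V" "open V" "V \<times> S \<subseteq> W" by blast
  have near: "dist (u (v + s)) (u s) < e" if "v \<in> V" "s \<in> S" for v s
    using V(3) that by (auto simp: W_def)
  have "open (V \<inter> uminus -` V)"
    by (intro open_Int V(2) open_vimage continuous_intros)
  moreover have "dist (u x) (u y) < e" if "x - y \<in> V \<inter> uminus -` V" for x y
  proof -
    consider "x \<in> S" | "y \<in> S" | "x \<notin> S" "y \<notin> S" by blast
    then show ?thesis
    proof cases
      case 1
      have "- (x - y) \<in> V" using that by (simp only: Int_iff vimage_eq)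
      from near[OF this 1] show ?thesis by (simp add: dist_commute)
    next
      case 2
      have "x - y \<in> V" using that by (simp only: Int_iff)
      from near[OF this 2] show ?thesis by simp
    next
      case 3
      then show ?thesis using assms(3) e by simp
    qed
  qed
  moreover have "0 \<in> V \<inter> uminus -` V" using V(1) by simp
  ultimately show "\<exists>V. open V \<and> 0 \<in> V \<and> (\<forall>x y. x - y \<in> V \<longrightarrow> dist (u x) (u y) < e)"
    by blast
qed

text \<open>
  Conjugation by the elements of a compact set is equicontinuous at \<open>0\<close>.
\<close>

lemma conjugation_tube:
  fixes V C :: "'a::topological_group_add set"
  assumes "compact C" "open V" "0 \<in> V"
  obtains W where "open W" "0 \<in> W" "\<And>w c. w \<in> W \<Longrightarrow> c \<in> C \<Longrightarrow> c + w - c \<in> V"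
proof -
  define T where "T = (\<lambda>p. snd p + fst p - snd p) -` V"
  have T: "open T" unfolding T_def by (intro open_vimage assms(2) continuous_intros)
  have "{0} \<times> C \<subseteq> T" using assms(3) by (auto simp: T_def)
  from Elementary_Topology.tube_lemma[OF assms(1) T this]
  obtain W where "0 \<in> W" "open W" "W \<times> C \<subseteq> T" by blast
  then show ?thesis by (intro that[of W]) (auto simp: T_def)
qed

lemma not_cocompact_trivial:
  assumes "\<not> compact (UNIV :: 'a::topological_group_add set)"
  shows "\<not> cocompact {0 :: 'a}"
proof
  assume "cocompact {0 :: 'a}"
  then obtain C :: "'a set" where "compact C" "\<And>x. \<exists>c\<in>C. \<exists>n\<in>{0}. x = c + n"
    unfolding cocompact_def by auto
  then have "C = UNIV" by auto
  with \<open>compact C\<close> assms show False by simp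
qed

text \<open>
  If the supports of the translates by \<open>x\<close> and \<open>y\<close> meet, then \<open>x\<close> lies in \<open>S - S + y + N\<close>, and
  invariance under \<open>N\<close> reduces it to the compact set \<open>S - S + y\<close>; so the orbit is sparse.
  It does not come from a compact set of parameters \<open>C\<close>: if the translates by \<open>x\<close> and by \<open>c\<close> in \<open>C\<close>
  agree, then evaluation at \<open>- x\<close> gives \<open>F (c - x) \<noteq> 0\<close>, so that \<open>x\<close> lies in \<open>- S + C + N\<close>.
\<close>

lemma central_bump_in_WS_minus_AP:
  fixes F :: "'a::topological_group_add \<Rightarrow> real"
  assumes N: "normal_subgroup_add N" "\<not> cocompact N"
    and bdd: "\<And>x. \<bar>F x\<bar> \<le> B" and tc: "translation_continuous F" and F0: "F 0 \<noteq> 0"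
    and central: "\<And>x y. F (x + y) = F (y + x)"
    and inv: "\<And>x n. n \<in> N \<Longrightarrow> F (x + n) = F x"
    and S: "compact S" and supp: "\<And>x. F x \<noteq> 0 \<Longrightarrow> \<exists>s\<in>S. \<exists>n\<in>N. x = s + n"
  shows "\<exists>f :: 'a \<Rightarrow>\<^sub>C complex. f \<in> WS \<and> f \<notin> AP"
proof -
  define f where "f = Bcontfun (\<lambda>x. complex_of_real (F x))"
  have "(\<lambda>x. complex_of_real (F x)) \<in> bcontfun"
    using translation_continuous_imp_continuous_on[OF tc] bdd
    by (intro bcontfun_normI[where b = B] continuous_intros) auto
  then have f [simp]: "apply_bcontfun f x = complex_of_real (F x)" for x
    by (simp add: f_def Bcontfun_inverse)
  have shift: "left_translate (c + n) f = left_translate c f" if "n \<in> N" for c n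
  proof (rule bcontfun_eqI)
    fix z
    have "F (c + n + z) = F (c + z + (- z + n + z))" by (simp only: group_normalize)
    also have "\<dots> = F (c + z)" by (rule inv) (simp add: normal_subgroup_add_conj N(1) that)
    finally show "apply_bcontfun (left_translate (c + n) f) z = apply_bcontfun (left_translate c f) z" by simp
  qed
  have sparse: "sparse_orbit f"
    unfolding sparse_orbit_def
  proof (intro allI exI conjI impI)
    fix y
    let ?T = "{a + b | a b. a \<in> uminus ` S \<and> b \<in> {y}}"
    let ?C = "{a + b | a b. a \<in> S \<and> b \<in> ?T}"
    show "compact ?C"
      by (intro compact_sum_set compact_uminus_set S) simp
    fix x assume "supports_meet f x y"
    then obtain z where "F (x + z) \<noteq> 0" "F (y + z) \<noteq> 0" by (auto simp: supports_meet_def)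
    then obtain s n s' n' where sn: "s \<in> S" "n \<in> N" "x + z = s + n" "s' \<in> S" "n' \<in> N" "y + z = s' + n'"
      using supp by metis
    define m where "m = - (- s' + y) + (n + - n') + (- s' + y)"
    have m: "m \<in> N"
      unfolding m_def by (intro normal_subgroup_add_conj normal_subgroup_add_diff N(1) sn)
    have "x = (x + z) + - (y + z) + y" by (simp only: group_normalize)
    also have "\<dots> = s + (- s' + y) + m" by (simp only: sn m_def group_normalize)
    finally have "left_translate x f = left_translate (s + (- s' + y)) f" using shift[OF m] by simp
    moreover have "s + (- s' + y) \<in> ?C" using sn by blast
    ultimately show "left_translate x f \<in> (\<lambda>c. left_translate c f) ` ?C" by blast
  qed
  have "continuous_on UNIV (\<lambda>x. left_translate x f)"
  proof (rule translation_continuous_imp_continuous_on, unfold translation_continuous_def, intro allI impI)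
    fix e :: real assume e: "0 < e"
    then obtain V where V: "open V" "0 \<in> V" "\<And>x y. x - y \<in> V \<Longrightarrow> dist (F x) (F y) < e / 2"
      using tc unfolding translation_continuous_def by (meson half_gt_zero)
    have "dist (left_translate x f) (left_translate y f) < e" if xy: "x - y \<in> V" for x y
    proof -
      have "dist (left_translate x f) (left_translate y f) \<le> e / 2"
      proof (rule dist_bound)
        fix z
        have "(x + z) - (y + z) = x - y" by (simp only: group_normalize)
        then have "dist (F (x + z)) (F (y + z)) < e / 2" using V(3) xy by metis
        then show "dist (apply_bcontfun (left_translate x f) z) (apply_bcontfun (left_translate y f) z) \<le> e / 2"
          by (simp add: dist_of_real)
      qed
      then show ?thesis using e by simp
    qed
    then show "\<exists>V. open V \<and> 0 \<in> V \<and> (\<forall>x y. x - y \<in> V \<longrightarrow> dist (left_translate x f) (left_translate y f) < e)"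
      using V by blast
  qed
  then have "f \<in> WS"
    using sparse by (intro sparse_central_imp_WS) (auto simp: central)
  moreover have "f \<notin> AP"
  proof (rule sparse_imp_not_AP[OF sparse])
    show "apply_bcontfun f 0 \<noteq> 0" using F0 by simp
    fix C :: "'a set" assume "compact C"
    define D where "D = {a + b | a b. a \<in> uminus ` S \<and> b \<in> C}"
    have "compact D"
      unfolding D_def by (intro compact_sum_set compact_uminus_set S \<open>compact C\<close>)
    with N(2) obtain x where x: "\<not> (\<exists>c\<in>D. \<exists>n\<in>N. x = c + n)"
      unfolding cocompact_def by blast
    have "left_translate x f \<noteq> left_translate c f" if c: "c \<in> C" for c
    proof
      assume "left_translate x f = left_translate c f"
      then have "apply_bcontfun (left_translate x f) (- x) = apply_bcontfun (left_translate c f) (- x)" by simp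
      then have "F (c + - x) \<noteq> 0" using F0 by simp
      then obtain s n where sn: "s \<in> S" "n \<in> N" "c + - x = s + n" using supp by blast
      define m where "m = - (- s + c) + - n + (- s + c)"
      have m: "m \<in> N"
        unfolding m_def using N(1) sn by (intro normal_subgroup_add_conj) (auto simp: normal_subgroup_add_def)
      have "x = - (c + - x) + c" by (simp only: group_normalize)
      also have "\<dots> = (- s + c) + m" by (simp only: sn m_def group_normalize)
      finally have "x = (- s + c) + m" .
      moreover have "- s + c \<in> D" using sn c by (auto simp: D_def)
      ultimately show False using x m by blast
    qed
    then show "\<exists>x. left_translate x f \<notin> (\<lambda>c. left_translate c f) ` C" by blast
  qed
  ultimately show ?thesis by blast
qed

section \<open>Nonnegative continuous functions with compact support\<close>

definition Cc :: "('a::topological_space \<Rightarrow> real) \<Rightarrow> bool" where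
  "Cc f \<longleftrightarrow> continuous_on UNIV f \<and> (\<forall>x. 0 \<le> f x) \<and> (\<exists>S. compact S \<and> (\<forall>x. x \<notin> S \<longrightarrow> f x = 0))"

lemma CcI:
  "continuous_on UNIV f \<Longrightarrow> (\<And>x. 0 \<le> f x) \<Longrightarrow> compact S \<Longrightarrow> (\<And>x. x \<notin> S \<Longrightarrow> f x = 0) \<Longrightarrow> Cc f"
  unfolding Cc_def by blast

lemma Cc_continuous: "Cc f \<Longrightarrow> continuous_on UNIV f"
  and Cc_nonneg: "Cc f \<Longrightarrow> 0 \<le> f x"
  by (simp_all add: Cc_def)

lemma Cc_support: 
  assumes "Cc f" 
  obtains S where "compact S" "\<And>x. x \<notin> S \<Longrightarrow> f x = 0"
  using assms unfolding Cc_def by blast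

lemma Cc_zero [simp]: "Cc (\<lambda>x. 0)"
  by (rule CcI[of _ "{}"]) auto

lemma Cc_combine:
  assumes f: "Cc f" and g: "Cc g" and h: "continuous_on UNIV h" "\<And>x. 0 \<le> h x"
    "\<And>x. f x = 0 \<Longrightarrow> g x = 0 \<Longrightarrow> h x = 0"
  shows "Cc h"
proof -
  obtain S where S: "compact S" "\<And>x. x \<notin> S \<Longrightarrow> f x = 0"
    by (rule Cc_support[OF f]) (rule that; assumption)
  obtain T where T: "compact T" "\<And>x. x \<notin> T \<Longrightarrow> g x = 0"
    by (rule Cc_support[OF g]) (rule that; assumption)
  show ?thesis
    by (rule CcI[OF h(1,2) compact_Un[OF S(1) T(1)]]) (use S T h(3) in auto)
qed

lemma Cc_add: "Cc f \<Longrightarrow> Cc g \<Longrightarrow> Cc (\<lambda>x. f x + g x)"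
  by (rule Cc_combine[of f g]) (simp_all add: Cc_nonneg Cc_continuous continuous_on_add)

lemma Cc_max: "Cc f \<Longrightarrow> Cc g \<Longrightarrow> Cc (\<lambda>x. max (f x) (g x))"
  by (rule Cc_combine[of f g]) (simp_all add: Cc_nonneg Cc_continuous continuous_on_max le_max_iff_disj)

lemma Cc_min: "Cc f \<Longrightarrow> Cc g \<Longrightarrow> Cc (\<lambda>x. min (f x) (g x))"
  by (rule Cc_combine[of f g]) (simp_all add: Cc_nonneg Cc_continuous continuous_on_min)

lemma Cc_mult: "continuous_on UNIV h \<Longrightarrow> (\<And>x. 0 \<le> h x) \<Longrightarrow> Cc f \<Longrightarrow> Cc (\<lambda>x. h x * f x)"
  by (rule Cc_combine[of f f]) (simp_all add: Cc_nonneg Cc_continuous continuous_on_mult)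

lemma Cc_scale: "0 \<le> c \<Longrightarrow> Cc f \<Longrightarrow> Cc (\<lambda>x. c * f x)"
  by (rule Cc_mult) auto

lemma Cc_sum: "finite A \<Longrightarrow> (\<And>i. i \<in> A \<Longrightarrow> Cc (f i)) \<Longrightarrow> Cc (\<lambda>x. \<Sum>i\<in>A. f i x)"
  by (induction A rule: finite_induct) (auto intro: Cc_add)

lemma Cc_homeo:
  assumes "Cc f" "continuous_on UNIV h" "continuous_on UNIV k" "\<And>x. k (h x) = x"
  shows "Cc (\<lambda>x. f (h x))"
proof -
  obtain S where S: "compact S" "\<And>x. x \<notin> S \<Longrightarrow> f x = 0"
    by (rule Cc_support[OF assms(1)]) (rule that; assumption)
  show ?thesis
  proof (rule CcI)
    show "continuous_on UNIV (\<lambda>x. f (h x))"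
      by (rule continuous_on_compose2[OF Cc_continuous[OF assms(1)] assms(2)]) simp
    show "compact (k ` S)"
      by (rule compact_continuous_image[OF continuous_on_subset[OF assms(3)] S(1)]) simp
    show "f (h x) = 0" if "x \<notin> k ` S" for x
      using that assms(4)[of x] S(2)[of "h x"] by force
  qed (simp add: Cc_nonneg assms(1))
qed

lemma Cc_left: "Cc f \<Longrightarrow> Cc (\<lambda>x. f (a + x))" for a :: "'a::topological_group_add"
  by (rule Cc_homeo[of f _ "\<lambda>x. - a + x"]) (auto intro!: continuous_intros simp: add.assoc[symmetric])

lemma Cc_uminus: "Cc f \<Longrightarrow> Cc (\<lambda>x. f (- x))" for f :: "'a::topological_group_add \<Rightarrow> real"
  by (rule Cc_homeo[of f _ "\<lambda>x. - x"]) (auto intro!: continuous_intros)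

lemma Cc_conj: "Cc f \<Longrightarrow> Cc (\<lambda>x. f (a + x - a))" for a :: "'a::topological_group_add"
  by (rule Cc_homeo[of f _ "\<lambda>x. - a + x + a"])
    (auto intro!: continuous_intros simp only: group_normalize)

text \<open>
  On the complement of \<open>S\<close> the quotient vanishes, with \<open>0 / 0 = 0\<close> where \<open>B\<close> has zeros.
\<close>

lemma Cc_divide:
  fixes f :: "'a::t2_space \<Rightarrow> real"
  assumes f: "Cc f" and S: "compact S" "\<And>x. x \<notin> S \<Longrightarrow> f x = 0"
    and B: "continuous_on UNIV B" "\<And>x. 0 \<le> B x" "\<And>x. x \<in> S \<Longrightarrow> 0 < B x"
  shows "Cc (\<lambda>x. f x / B x)"
proof (rule CcI[OF _ _ S(1)])
  have "open {x. 0 < B x}" by (rule open_Collect_less) (auto intro: continuous_intros B(1))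
  moreover have "open (- S)" using S(1) by (simp add: compact_imp_closed open_Compl)
  moreover have "continuous_on {x. 0 < B x} (\<lambda>x. f x / B x)"
    by (intro continuous_intros continuous_on_subset[OF Cc_continuous[OF f]] continuous_on_subset[OF B(1)]) auto
  moreover have "continuous_on (- S) (\<lambda>x. f x / B x)"
    by (rule continuous_on_eq[of _ "\<lambda>_. 0"]) (use S(2) in auto)
  ultimately have "continuous_on ({x. 0 < B x} \<union> - S) (\<lambda>x. f x / B x)"
    by (intro continuous_on_open_Un)
  moreover have "{x. 0 < B x} \<union> - S = UNIV" using B(3) by auto
  ultimately show "continuous_on UNIV (\<lambda>x. f x / B x)" by simp
qed (use f B S in \<open>auto simp: Cc_nonneg\<close>)

lemma Cc_bounded:
  assumes "Cc f"
  obtains M where "0 < M" "\<And>x. f x \<le> M"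
proof -
  obtain S where S: "compact S" "\<And>x. x \<notin> S \<Longrightarrow> f x = 0"
    by (rule Cc_support[OF assms]) (rule that; assumption)
  have "bounded (f ` S)"
    by (intro compact_imp_bounded compact_continuous_image S(1) continuous_on_subset[OF Cc_continuous[OF assms]]) simp
  then obtain B where B: "\<And>x. x \<in> S \<Longrightarrow> \<bar>f x\<bar> \<le> B" unfolding bounded_iff by auto
  show ?thesis
  proof (rule that[of "max B 1"])
    show "f x \<le> max B 1" for x
      using B[of x] S(2)[of x] by (cases "x \<in> S") auto
  qed simp
qed

lemma Hausdorff_space_euclidean_t2: "Hausdorff_space (euclidean :: 'a::t2_space topology)"
  unfolding Hausdorff_space_def
proof (intro allI impI)
  fix x y :: 'a assume "x \<in> topspace euclidean \<and> y \<in> topspace euclidean \<and> x \<noteq> y"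
  then have "x \<noteq> y" by blast
  from hausdorff[OF this]
  show "\<exists>U V. openin euclidean U \<and> openin euclidean V \<and> x \<in> U \<and> y \<in> V \<and> disjnt U V"
    by (simp add: disjnt_def)
qed

lemma completely_regular_locally_compact:
  assumes "locally_compact_space (euclidean :: 'a::t2_space topology)"
  shows "completely_regular_space (euclidean :: 'a topology)"
  using assms locally_compact_regular_imp_completely_regular_space Hausdorff_space_euclidean_t2 by blast

text \<open>
  Take a Urysohn function \<open>g\<close> that is \<open>0\<close> at the identity and \<open>1\<close> off a small neighbourhood with compact
  closure. The set where \<open>g \<le> 1/2\<close> is closed and lies in that neighbourhood, so it is compact, and
  \<open>max 0 (1 - 2 * g)\<close> vanishes off it.
\<close>

lemma Cc_bump_exists:
  fixes V :: "'a::{topological_group_add, t2_space} set"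
  assumes lc: "locally_compact_space (euclidean :: 'a topology)" and V: "open V" "0 \<in> V"
  obtains u where "Cc u" "\<And>x. u x \<le> 1" "u 0 = 1" "\<And>x. x \<notin> V \<Longrightarrow> u x = 0"
proof -
  have "\<exists>U K :: 'a set. open U \<and> compact K \<and> 0 \<in> U \<and> U \<subseteq> K"
    using lc[unfolded locally_compact_space_def, rule_format, of 0] by simp
  then obtain U K :: "'a set" where U: "open U" "compact K" "0 \<in> U" "U \<subseteq> K"
    by (elim exE conjE)
  have "completely_regular_space (euclidean :: 'a topology)"
    by (rule completely_regular_locally_compact[OF lc])
  moreover have "closedin euclidean (- (U \<inter> V))"
    unfolding closed_closedin[symmetric] by (intro closed_Compl open_Int U V)
  moreover have "0 \<in> topspace euclidean - (- (U \<inter> V))" using U V by simp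
  ultimately obtain g :: "'a \<Rightarrow> real" where g: "continuous_map euclidean (top_of_set {0..1}) g"
    "g 0 = 0" "g ` (- (U \<inter> V)) \<subseteq> {1}"
    unfolding completely_regular_space_def by meson
  have cg: "continuous_on UNIV g"
    using g(1) by (simp add: continuous_map_in_subtopology)
  have g01: "0 \<le> g x" "g x \<le> 1" for x
    using g(1) by (auto simp: continuous_map_in_subtopology)
  define u where "u = (\<lambda>x. max 0 (1 - 2 * g x))"
  define S where "S = K \<inter> g -` {..1/2}"
  have sub: "g -` {..1/2} \<subseteq> U \<inter> V"
  proof
    fix x assume x: "x \<in> g -` {..1/2}"
    show "x \<in> U \<inter> V"
    proof (rule ccontr)
      assume "x \<notin> U \<inter> V"
      then have "g x \<in> g ` (- (U \<inter> V))" by blast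
      then have "g x = 1" using g(3) by blast
      then show False using x by simp
    qed
  qed
  have zero: "u x = 0" if "x \<notin> S" for x
  proof (cases "g x \<le> 1/2")
    case True
    then have "x \<in> S" using sub U(4) by (auto simp: S_def)
    with that show ?thesis by simp
  qed (simp add: u_def)
  have "compact S"
    unfolding S_def by (intro compact_Int_closed U(2) closed_vimage cg closed_atMost)
  moreover have "continuous_on UNIV u" unfolding u_def by (intro continuous_intros cg)
  ultimately have "Cc u" using zero by (intro CcI[of u S]) (auto simp: u_def)
  then show ?thesis
  proof (rule that)
    show "u x \<le> 1" for x using g01(1)[of x] by (simp add: u_def)
    show "u 0 = 1" using g(2) by (simp add: u_def)
    show "u x = 0" if "x \<notin> V" for x
    proof (rule zero)
      show "x \<notin> S" unfolding S_def using that sub by blast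
    qed
  qed
qed

lemma Cc_translation_continuous: "Cc f \<Longrightarrow> translation_continuous f" for f :: "'a::topological_group_add \<Rightarrow> real"
  using Cc_support translation_continuous_compact_support Cc_continuous by metis

lemma Cc_left_uniform:
  fixes f :: "'a::topological_group_add \<Rightarrow> real"
  assumes "Cc f" "0 < e"
  shows "\<exists>V. open V \<and> 0 \<in> V \<and> (\<forall>x y. - x + y \<in> V \<longrightarrow> \<bar>f x - f y\<bar> < e)"
proof -
  obtain V where V: "open V" "0 \<in> V" "\<And>x y. x - y \<in> V \<Longrightarrow> dist (f (- x)) (f (- y)) < e"
    using Cc_translation_continuous[OF Cc_uminus[OF assms(1)]] assms(2)
    unfolding translation_continuous_def by blast
  have "\<bar>f x - f y\<bar> < e" if "- x + y \<in> V" for x y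
    using V(3)[of "- x" "- y"] that by (simp add: dist_real_def)
  with V show ?thesis by blast
qed

lemma Cc_right_uniform:
  fixes f :: "'a::topological_group_add \<Rightarrow> real"
  assumes "Cc f" "0 < e"
  shows "\<exists>V. open V \<and> 0 \<in> V \<and> (\<forall>x y. x - y \<in> V \<longrightarrow> \<bar>f x - f y\<bar> < e)"
  using Cc_translation_continuous[OF assms(1)] assms(2)
  unfolding translation_continuous_def dist_real_def by blast

section \<open>Nilpotent groups\<close>

text \<open>
  The bump is the supremum of \<open>u\<close> over all conjugates and all \<open>N\<close>-translates, which makes it central
  and \<open>N\<close>-invariant. Conjugation by an element of \<open>Z\<close> acts trivially modulo \<open>N\<close>, so conjugation by a
  compact set \<open>C\<close> with \<open>G = C + Z\<close> yields the same values; this gives equicontinuity of the family under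
  the supremum and control of the support.
\<close>

lemma central_extension_WS_minus_AP:
  fixes N Z :: "'a::{topological_group_add, t2_space} set"
  assumes lc: "locally_compact_space (euclidean :: 'a topology)"
    and N: "normal_subgroup_add N" "\<not> cocompact N"
    and Z: "cocompact Z" "\<And>z x. z \<in> Z \<Longrightarrow> z + x - z - x \<in> N"
  shows "\<exists>f :: 'a \<Rightarrow>\<^sub>C complex. f \<in> WS \<and> f \<notin> AP"
proof -
  obtain C where C: "compact C" "\<And>x. \<exists>c\<in>C. \<exists>z\<in>Z. x = c + z"
    using Z(1) unfolding cocompact_def by blast
  obtain u :: "'a \<Rightarrow> real" where u: "Cc u" "\<And>x. u x \<le> 1" "u 0 = 1"
    by (rule Cc_bump_exists[OF lc open_UNIV UNIV_I]) (rule that; assumption)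
  obtain S where S: "compact S" "\<And>x. x \<notin> S \<Longrightarrow> u x = 0"
    by (rule Cc_support[OF u(1)]) (rule that; assumption)
  have add_N: "x + y \<in> N" if "x \<in> N" "y \<in> N" for x y
    using N(1) that by (simp add: normal_subgroup_add_def)
  have conj_N: "g + x - g \<in> N" if "x \<in> N" for g x
    using N(1) that by (simp add: normal_subgroup_add_def)
  have minus_N: "- x \<in> N" if "x \<in> N" for x
    using N(1) that by (simp add: normal_subgroup_add_def)
  have zero_N: "0 \<in> N" using N(1) by (simp add: normal_subgroup_add_def)
  define A where "A = (\<lambda>x. {u (g + x - g + n) | g n. n \<in> N})"
  define F where "F = (\<lambda>x. Sup (A x))"
  have A_ne: "A x \<noteq> {}" for x unfolding A_def using zero_N by blast
  have A_bdd: "bdd_above (A x)" for x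
    unfolding A_def by (rule bdd_aboveI[of _ 1]) (use u(2) in auto)
  have F_upper: "u (g + x - g + n) \<le> F x" if "n \<in> N" for g x n
    unfolding F_def using A_bdd that by (intro cSup_upper) (auto simp: A_def)
  have F_least: "F x \<le> b" if "\<And>g n. n \<in> N \<Longrightarrow> u (g + x - g + n) \<le> b" for x b
    unfolding F_def using A_ne that by (intro cSup_least) (auto simp: A_def)
  have F_nonneg: "0 \<le> F x" for x
    using order_trans[OF Cc_nonneg[OF u(1)] F_upper[OF zero_N]] .
  \<comment> \<open>Modulo \<open>N\<close> conjugation by \<open>c + z\<close> agrees with conjugation by \<open>c\<close>, so \<open>C\<close> suffices.\<close>
  have reduce: "\<exists>c\<in>C. \<exists>n'\<in>N. g + x - g + n = c + x - c + n'" if n: "n \<in> N" for g x n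
  proof -
    obtain c z where cz: "c \<in> C" "z \<in> Z" "g = c + z" using C(2) by blast
    define m where "m = - x + (z + x - z - x) + x"
    have m: "m \<in> N" unfolding m_def by (intro normal_subgroup_add_conj N(1) Z(2) cz)
    have "g + x - g + n = c + x - c + ((c + m - c) + n)"
      by (simp only: cz m_def group_normalize)
    then show ?thesis using cz(1) add_N[OF conj_N[OF m] n] by blast
  qed
  have F_le: "F x \<le> F y + e" if V: "\<And>p q. p - q \<in> V \<Longrightarrow> u p \<le> u q + e" "\<And>c. c \<in> C \<Longrightarrow> c + (x - y) - c \<in> V"
    for x y V e
  proof (rule F_least)
    fix g n assume "n \<in> N"
    then obtain c n' where c: "c \<in> C" "n' \<in> N" "g + x - g + n = c + x - c + n'"
      using reduce by blast
    have "(c + x - c + n') - (c + y - c + n') = c + (x - y) - c"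
      by (simp only: group_normalize)
    then have "u (c + x - c + n') \<le> u (c + y - c + n') + e"
      using V(1) V(2)[OF c(1)] by metis
    also have "\<dots> \<le> F y + e" using F_upper[OF c(2)] by simp
    finally show "u (g + x - g + n) \<le> F y + e" by (simp only: c(3))
  qed
  have tc: "translation_continuous F"
    unfolding translation_continuous_def
  proof (intro allI impI)
    fix e :: real assume e: "0 < e"
    obtain V where V: "open V" "0 \<in> V" "\<And>x y. x - y \<in> V \<Longrightarrow> dist (u x) (u y) < e / 2"
      using Cc_translation_continuous[OF u(1)] e
      unfolding translation_continuous_def by (meson half_gt_zero)
    obtain W where W: "open W" "0 \<in> W" "\<And>w c. w \<in> W \<Longrightarrow> c \<in> C \<Longrightarrow> c + w - c \<in> V"
      using conjugation_tube[OF C(1) V(1,2)] by blast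
    have u_le: "u p \<le> u q + e / 2" if "p - q \<in> V" for p q
      using V(3)[OF that] unfolding dist_real_def by linarith
    have "open (W \<inter> uminus -` W)"
      by (intro open_Int W(1) open_vimage continuous_intros)
    moreover have "0 \<in> W \<inter> uminus -` W" using W(2) by simp
    moreover have "dist (F x) (F y) < e" if xy: "x - y \<in> W \<inter> uminus -` W" for x y
    proof -
      have "x - y \<in> W" "y - x \<in> W"
        using xy by simp_all
      then have "F x \<le> F y + e / 2" "F y \<le> F x + e / 2"
        using F_le[of V "e/2" x y] F_le[of V "e/2" y x] u_le W(3) by blast+
      then show ?thesis using e unfolding dist_real_def abs_less_iff by (simp add: field_simps)
    qed
    ultimately show "\<exists>V. open V \<and> 0 \<in> V \<and> (\<forall>x y. x - y \<in> V \<longrightarrow> dist (F x) (F y) < e)"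
      by blast
  qed
  have conj_le: "F (h + x - h) \<le> F x" for h x
  proof (rule F_least)
    fix g n assume n: "n \<in> N"
    have "g + (h + x - h) - g + n = (g + h) + x - (g + h) + n" by (simp only: group_normalize)
    then show "u (g + (h + x - h) - g + n) \<le> F x" using F_upper[OF n, of "g + h" x] by simp
  qed
  have central: "F (x + y) = F (y + x)" for x y
  proof (rule antisym)
    have "x + y = x + (y + x) - x" "y + x = y + (x + y) - y" by (simp_all only: group_normalize)
    then show "F (x + y) \<le> F (y + x)" "F (y + x) \<le> F (x + y)"
      using conj_le[of x "y + x"] conj_le[of y "x + y"] by simp_all
  qed
  have shift_le: "F (x + m) \<le> F x" if m: "m \<in> N" for x m
  proof (rule F_least)
    fix g n assume n: "n \<in> N"
    have "g + (x + m) - g + n = g + x - g + ((g + m - g) + n)" by (simp only: group_normalize)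
    then show "u (g + (x + m) - g + n) \<le> F x" using F_upper[OF add_N[OF conj_N[OF m] n], of g x] by simp
  qed
  have inv: "F (x + m) = F x" if m: "m \<in> N" for x m
    using shift_le[OF m, of x] shift_le[OF minus_N[OF m], of "x + m"] by (simp add: add.assoc)
  let ?S = "{a + b | a b. a \<in> uminus ` C \<and> b \<in> {a + b | a b. a \<in> S \<and> b \<in> C}}"
  show ?thesis
  proof (rule central_bump_in_WS_minus_AP[OF N _ tc _ central inv])
    show "\<bar>F x\<bar> \<le> 1" for x
      using F_nonneg[of x] F_least[of x 1] u(2) by simp
    have "1 \<le> F 0" using F_upper[OF zero_N, of 0 0] u(3) by simp
    then show "F 0 \<noteq> 0" by simp
    show "compact ?S" by (intro compact_sum_set compact_uminus_set S(1) C(1))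
    fix x assume "F x \<noteq> 0"
    have "\<exists>g n. n \<in> N \<and> u (g + x - g + n) \<noteq> 0"
    proof (rule ccontr)
      assume "\<not> ?thesis"
      then have "F x \<le> 0" by (intro F_least) auto
      with F_nonneg[of x] \<open>F x \<noteq> 0\<close> show False by simp
    qed
    then obtain g n where gn: "n \<in> N" "u (g + x - g + n) \<noteq> 0" by blast
    then obtain c n' where c: "c \<in> C" "n' \<in> N" "g + x - g + n = c + x - c + n'"
      using reduce by blast
    define s where "s = c + x - c + n'"
    have s: "s \<in> S" using gn(2) S(2) unfolding c(3) s_def by blast
    have "x = - c + (s + c) + (- c + - n' + c)"
      by (simp only: s_def group_normalize)
    moreover have "- c + - n' + c \<in> N" by (intro normal_subgroup_add_conj N(1) minus_N c)
    moreover have "- c + (s + c) \<in> ?S" using c(1) s by blast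
    ultimately show "\<exists>s\<in>?S. \<exists>n\<in>N. x = s + n" by blast
  qed
qed

lemma normal_subgroup_upper_central: "normal_subgroup_add (upper_central n :: 'a::group_add set)"
proof (induction n)
  case 0
  show ?case by (simp add: normal_subgroup_add_def)
next
  case (Suc n)
  let ?Z = "upper_central n :: 'a set"
  have add: "x + y \<in> ?Z" if "x \<in> ?Z" "y \<in> ?Z" for x y
    using Suc that by (simp add: normal_subgroup_add_def)
  have conj: "g + x - g \<in> ?Z" if "x \<in> ?Z" for g x
    using Suc that by (simp add: normal_subgroup_add_def)
  have minus: "- x \<in> ?Z" if "x \<in> ?Z" for x
    using Suc that by (simp add: normal_subgroup_add_def)
  have zero: "0 \<in> ?Z" using Suc by (simp add: normal_subgroup_add_def)
  let ?Y = "upper_central (Suc n) :: 'a set"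
  have comm: "x + y - x - y \<in> ?Z" if "x \<in> ?Y" for x y using that by simp
  have Y: "x \<in> ?Y" if "\<And>y. x + y - x - y \<in> ?Z" for x using that by simp
  have "0 \<in> ?Y" by (rule Y) (simp add: zero)
  moreover have "- x \<in> ?Y" if x: "x \<in> ?Y" for x
  proof (rule Y)
    fix y
    have "- x + y - (- x) - y = - x + - (x + y - x - y) + x" by (simp only: group_normalize)
    then show "- x + y - (- x) - y \<in> ?Z"
      using normal_subgroup_add_conj[OF Suc minus[OF comm[OF x]], of x y] by simp
  qed
  moreover have "g + x - g \<in> ?Y" if x: "x \<in> ?Y" for g x
  proof (rule Y)
    fix y
    define w where "w = - g + y + g"
    have "(g + x - g) + y - (g + x - g) - y = g + (x + w - x - w) - g"
      by (simp only: w_def group_normalize)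
    then show "(g + x - g) + y - (g + x - g) - y \<in> ?Z" using conj[OF comm[OF x], of g w] by simp
  qed
  moreover have "x + x' \<in> ?Y" if x: "x \<in> ?Y" "x' \<in> ?Y" for x x'
  proof (rule Y)
    fix y
    have "(x + x') + y - (x + x') - y = (x + (x' + y - x' - y) - x) + (x + y - x - y)"
      by (simp only: group_normalize)
    then show "(x + x') + y - (x + x') - y \<in> ?Z"
      using add[OF conj[OF comm[OF x(2), of y], of x] comm[OF x(1), of y]] by (simp only:)
  qed
  ultimately show ?case unfolding normal_subgroup_add_def by blast
qed

text \<open>
  Compactness of the quotients of the upper central series jumps somewhere from false to true.
\<close>

lemma nilpotent_WS_minus_AP:
  assumes lc: "locally_compact_space (euclidean :: 'a::{topological_group_add, t2_space} topology)"
    and nc: "\<not> compact (UNIV :: 'a set)"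
    and nil: "nilpotent_group TYPE('a)"
  shows "\<exists>f :: 'a \<Rightarrow>\<^sub>C complex. f \<in> WS \<and> f \<notin> AP"
proof -
  define P where "P = (\<lambda>n. cocompact (upper_central n :: 'a set))"
  obtain n where n: "upper_central n = (UNIV :: 'a set)"
    using nil unfolding nilpotent_group_def by blast
  have Pn: "P n"
    unfolding P_def cocompact_def n
  proof (intro exI[of _ "{0}"] conjI allI)
    show "\<exists>c\<in>{0}. \<exists>n\<in>UNIV. x = c + n" for x :: 'a by simp
  qed simp
  have "\<not> P 0" using not_cocompact_trivial[OF nc] by (simp add: P_def)
  then obtain k where k: "\<not> P k" "P (Suc k)"
    using Pn ex_least_nat_less[of P n] by (metis dual_order.refl)
  show ?thesis
  proof (rule central_extension_WS_minus_AP[OF lc normal_subgroup_upper_central])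
    show "\<not> cocompact (upper_central k :: 'a set)" using k(1) unfolding P_def .
    show "cocompact (upper_central (Suc k) :: 'a set)" using k(2) unfolding P_def .
    show "z + x - z - x \<in> upper_central k" if "z \<in> upper_central (Suc k)" for z x :: 'a
      using that by simp
  qed
qed

section \<open>Covering indices\<close>

definition translate_combination :: "(real \<times> 'a::group_add) list \<Rightarrow> ('a \<Rightarrow> real) \<Rightarrow> 'a \<Rightarrow> real" where
  "translate_combination l \<phi> x = (\<Sum>(c, s)\<leftarrow>l. c * \<phi> (s + x))"

abbreviation weight :: "(real \<times> 'a) list \<Rightarrow> real" where
  "weight l \<equiv> sum_list (map fst l)"

abbreviation nonneg_weights :: "(real \<times> 'a) list \<Rightarrow> bool" where
  "nonneg_weights l \<equiv> \<forall>p\<in>set l. 0 \<le> fst p"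

lemma translate_combination_simps [simp]:
  "translate_combination [] \<phi> x = 0"
  "translate_combination ((c, s) # l) \<phi> x = c * \<phi> (s + x) + translate_combination l \<phi> x"
  "translate_combination (l @ m) \<phi> x = translate_combination l \<phi> x + translate_combination m \<phi> x"
  by (simp_all add: translate_combination_def)

lemma weight_nonneg: "nonneg_weights l \<Longrightarrow> 0 \<le> weight l"
  by (rule sum_list_nonneg) auto

lemma Cc_translate_combination:
  fixes \<phi> :: "'a::topological_group_add \<Rightarrow> real"
  assumes "Cc \<phi>"
  shows "nonneg_weights l \<Longrightarrow> Cc (translate_combination l \<phi>)"
proof (induction l)
  case Nil
  have "translate_combination [] \<phi> = (\<lambda>x. 0)" by (rule ext) simp
  then show ?case by simp
next
  case (Cons p l)
  obtain c s where p: "p = (c, s)" by force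
  have "translate_combination (p # l) \<phi> = (\<lambda>x. c * \<phi> (s + x) + translate_combination l \<phi> x)"
    by (rule ext) (simp add: p)
  then show ?case using Cons p by (auto intro!: Cc_add Cc_scale Cc_left assms)
qed

lemma translate_combination_le:
  assumes "nonneg_weights l" "\<And>x. \<phi> x \<le> M"
  shows "translate_combination l \<phi> x \<le> weight l * M"
  using assms(1)
proof (induction l)
  case (Cons p l)
  obtain c s where p: "p = (c, s)" by force
  have "c * \<phi> (s + x) \<le> c * M" using Cons.prems assms(2) p by (auto intro: mult_left_mono)
  then show ?case using Cons p by (auto simp: algebra_simps)
qed simp

text \<open>
  Finitely many translates of the set where \<open>\<phi>\<close> exceeds half of its value at \<open>p\<close> cover \<open>S\<close>.
\<close>

lemma translate_combination_dominates:
  fixes \<phi> :: "'a::topological_group_add \<Rightarrow> real"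
  assumes S: "compact S" and \<phi>: "Cc \<phi>" "0 < \<phi> p" and B: "0 \<le> B"
  obtains l where "nonneg_weights l" "\<And>x. x \<in> S \<Longrightarrow> B \<le> translate_combination l \<phi> x"
proof -
  define U where "U = (\<lambda>s. (\<lambda>x. \<phi> ((p - s) + x)) -` {\<phi> p / 2<..})"
  have "open (U s)" for s
    unfolding U_def by (intro open_vimage open_greaterThan Cc_continuous Cc_left \<phi>)
  moreover have "S \<subseteq> (\<Union>s\<in>S. U s)"
    using \<phi>(2) by (force simp: U_def)
  ultimately obtain T where T: "T \<subseteq> S" "finite T" "S \<subseteq> (\<Union>s\<in>T. U s)"
    using compactE_image[OF S] by metis
  obtain ts where ts: "set ts = T" using finite_list[OF T(2)] by blast
  define c where "c = 2 * B / \<phi> p"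
  have c: "0 \<le> c" using B \<phi>(2) by (simp add: c_def)
  have single: "c * \<phi> ((p - s) + x) \<le> translate_combination (map (\<lambda>s. (c, p - s)) ts) \<phi> x" if "s \<in> set ts" for s x
    unfolding translate_combination_def using that
  proof (induction ts)
    case (Cons t ts)
    have "0 \<le> (\<Sum>(c, s)\<leftarrow>map (\<lambda>s. (c, p - s)) ts. c * \<phi> (s + x))"
      by (rule sum_list_nonneg) (use c Cc_nonneg[OF \<phi>(1)] in auto)
    moreover have "0 \<le> c * \<phi> ((p - t) + x)" using c Cc_nonneg[OF \<phi>(1)] by simp
    ultimately show ?case using Cons by (auto simp del: map_map)
  qed simp
  show ?thesis
  proof (rule that[of "map (\<lambda>s. (c, p - s)) ts"])
    fix x assume "x \<in> S"
    then obtain s where s: "s \<in> set ts" "\<phi> p / 2 < \<phi> ((p - s) + x)"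
      using T(3) ts by (auto simp: U_def)
    have "B = c * (\<phi> p / 2)" using \<phi>(2) by (simp add: c_def)
    also have "\<dots> \<le> c * \<phi> ((p - s) + x)" using s(2) c by (intro mult_left_mono) auto
    also have "\<dots> \<le> translate_combination (map (\<lambda>s. (c, p - s)) ts) \<phi> x" by (rule single[OF s(1)])
    finally show "B \<le> translate_combination (map (\<lambda>s. (c, p - s)) ts) \<phi> x" .
  qed (use c in auto)
qed

lemma Cc_le_translate_combination:
  fixes \<phi> f :: "'a::topological_group_add \<Rightarrow> real"
  assumes f: "Cc f" and \<phi>: "Cc \<phi>" "0 < \<phi> p"
  obtains l where "nonneg_weights l" "\<And>x. f x \<le> translate_combination l \<phi> x"
proof -
  obtain S where S: "compact S" "\<And>x. x \<notin> S \<Longrightarrow> f x = 0"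
    by (rule Cc_support[OF f]) (rule that; assumption)
  obtain M where M: "0 < M" "\<And>x. f x \<le> M"
    by (rule Cc_bounded[OF f]) (rule that; assumption)
  obtain l where l: "nonneg_weights l" "\<And>x. x \<in> S \<Longrightarrow> M \<le> translate_combination l \<phi> x"
    using translate_combination_dominates[OF S(1) \<phi>, of M] M(1) by auto
  show ?thesis
  proof (rule that[OF l(1)])
    show "f x \<le> translate_combination l \<phi> x" for x
      using M(2)[of x] l(2)[of x] S(2)[of x] Cc_nonneg[OF Cc_translate_combination[OF \<phi>(1) l(1)], of x]
      by (cases "x \<in> S") auto
  qed
qed

text \<open>
  Weil's index \<open>(f : \<phi>)\<close>: how much of \<open>\<phi>\<close>, spread by left translations, is needed to cover \<open>f\<close>. As a
  function of \<open>f\<close> it is left invariant, monotone, subadditive and positively homogeneous; as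
  \<open>\<phi>\<close> concentrates at \<open>0\<close>, it becomes additive up to normalization.
\<close>

definition covering_index :: "('a::group_add \<Rightarrow> real) \<Rightarrow> ('a \<Rightarrow> real) \<Rightarrow> real" where
  "covering_index f \<phi> = Inf {weight l | l. nonneg_weights l \<and> (\<forall>x. f x \<le> translate_combination l \<phi> x)}"

context
  fixes \<phi> :: "'a::topological_group_add \<Rightarrow> real" and p
  assumes \<phi>: "Cc \<phi>" "0 < \<phi> p"
begin

lemma covering_index_le:
  assumes "nonneg_weights l" "\<And>x. f x \<le> translate_combination l \<phi> x"
  shows "covering_index f \<phi> \<le> weight l"
  unfolding covering_index_def
  by (rule cInf_lower) (use assms weight_nonneg in \<open>auto intro!: bdd_belowI[of _ 0]\<close>)

lemma covering_index_greatest: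
  assumes "Cc f" "\<And>l. nonneg_weights l \<Longrightarrow> (\<And>x. f x \<le> translate_combination l \<phi> x) \<Longrightarrow> b \<le> weight l"
  shows "b \<le> covering_index f \<phi>"
  unfolding covering_index_def
proof (rule cInf_greatest)
  obtain l where "nonneg_weights l" "\<And>x. f x \<le> translate_combination l \<phi> x"
    by (rule Cc_le_translate_combination[OF assms(1) \<phi>]) (rule that; assumption)
  then show "{weight l | l. nonneg_weights l \<and> (\<forall>x. f x \<le> translate_combination l \<phi> x)} \<noteq> {}"
    by blast
qed (use assms(2) in blast)

lemma covering_index_nonneg: "Cc f \<Longrightarrow> 0 \<le> covering_index f \<phi>"
  by (rule covering_index_greatest) (auto intro: weight_nonneg)

lemma covering_index_mono:
  assumes "Cc g" "\<And>x. f x \<le> g x"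
  shows "covering_index f \<phi> \<le> covering_index g \<phi>"
  by (rule covering_index_greatest[OF assms(1)]) (meson assms(2) covering_index_le order_trans)

lemma covering_index_pos:
  assumes "Cc f" "0 < f q"
  shows "0 < covering_index f \<phi>"
proof -
  obtain M where M: "0 < M" "\<And>x. \<phi> x \<le> M"
    by (rule Cc_bounded[OF \<phi>(1)]) (rule that; assumption)
  have "f q / M \<le> covering_index f \<phi>"
  proof (rule covering_index_greatest[OF assms(1)])
    fix l assume l: "nonneg_weights l" "\<And>x. f x \<le> translate_combination l \<phi> x"
    have "f q \<le> weight l * M"
      using l(2)[of q] translate_combination_le[where \<phi> = \<phi> and M = M and x = q, OF l(1) M(2)] by linarith
    then show "f q / M \<le> weight l" using M(1) by (simp add: pos_divide_le_eq)
  qed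
  moreover have "0 < f q / M" using assms(2) M(1) by simp
  ultimately show ?thesis by linarith
qed

lemma covering_index_add:
  assumes "Cc f" "Cc g"
  shows "covering_index (\<lambda>x. f x + g x) \<phi> \<le> covering_index f \<phi> + covering_index g \<phi>"
proof -
  let ?h = "\<lambda>x. f x + g x"
  have "covering_index ?h \<phi> - covering_index f \<phi> \<le> covering_index g \<phi>"
  proof (rule covering_index_greatest[OF assms(2)])
    fix m assume m: "nonneg_weights m" "\<And>x. g x \<le> translate_combination m \<phi> x"
    have "covering_index ?h \<phi> - weight m \<le> covering_index f \<phi>"
    proof (rule covering_index_greatest[OF assms(1)])
      fix l assume l: "nonneg_weights l" "\<And>x. f x \<le> translate_combination l \<phi> x"
      have "covering_index ?h \<phi> \<le> weight (l @ m)"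
        by (rule covering_index_le) (use l m in \<open>auto intro: add_mono\<close>)
      then show "covering_index ?h \<phi> - weight m \<le> weight l" by simp
    qed
    then show "covering_index ?h \<phi> - covering_index f \<phi> \<le> weight m" by linarith
  qed
  then show ?thesis by linarith
qed

lemma covering_index_zero: "covering_index (\<lambda>x. 0) \<phi> = 0"
  using covering_index_le[of "[]" "\<lambda>x. 0"] covering_index_nonneg[OF Cc_zero] by simp

lemma covering_index_scale_le:
  assumes "Cc f" "0 < c"
  shows "covering_index (\<lambda>x. c * f x) \<phi> \<le> c * covering_index f \<phi>"
proof -
  have "covering_index (\<lambda>x. c * f x) \<phi> / c \<le> covering_index f \<phi>"
  proof (rule covering_index_greatest[OF assms(1)])
    fix l assume l: "nonneg_weights l" "\<And>x. f x \<le> translate_combination l \<phi> x"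
    let ?l = "map (\<lambda>(d, s). (c * d, s)) l"
    have w: "weight ?l = c * weight l" by (induction l) (auto simp: algebra_simps)
    have t: "translate_combination ?l \<phi> x = c * translate_combination l \<phi> x" for x
      by (induction l) (auto simp: algebra_simps)
    have "covering_index (\<lambda>x. c * f x) \<phi> \<le> weight ?l"
      by (rule covering_index_le) (use l assms(2) in \<open>auto simp: t intro!: mult_left_mono\<close>)
    then show "covering_index (\<lambda>x. c * f x) \<phi> / c \<le> weight l"
      unfolding w using assms(2) by (simp add: pos_divide_le_eq mult.commute)
  qed
  then show ?thesis using assms(2) by (simp add: pos_divide_le_eq mult.commute)
qed

lemma covering_index_scale:
  assumes "Cc f" "0 \<le> c"
  shows "covering_index (\<lambda>x. c * f x) \<phi> = c * covering_index f \<phi>"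
proof (cases "c = 0")
  case True
  then show ?thesis by (simp add: covering_index_zero)
next
  case False
  with assms(2) have c: "0 < c" by simp
  have "covering_index f \<phi> = covering_index (\<lambda>x. inverse c * (c * f x)) \<phi>"
    using c by (simp add: mult.assoc[symmetric])
  also have "\<dots> \<le> inverse c * covering_index (\<lambda>x. c * f x) \<phi>"
    by (rule covering_index_scale_le) (use c assms(1) in \<open>auto intro: Cc_scale\<close>)
  finally have "c * covering_index f \<phi> \<le> covering_index (\<lambda>x. c * f x) \<phi>"
    using c by (simp add: field_simps)
  then show ?thesis using covering_index_scale_le[OF assms(1) c] by linarith
qed

lemma covering_index_left_le:
  assumes "Cc f"
  shows "covering_index (\<lambda>x. f (a + x)) \<phi> \<le> covering_index f \<phi>"
proof (rule covering_index_greatest[OF assms])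
  fix l assume l: "nonneg_weights l" "\<And>x. f x \<le> translate_combination l \<phi> x"
  let ?l = "map (\<lambda>(c, s). (c, s + a)) l"
  have w: "weight ?l = weight l" by (induction l) auto
  have t: "translate_combination ?l \<phi> x = translate_combination l \<phi> (a + x)" for x
    by (induction l) (auto simp: add.assoc)
  have "covering_index (\<lambda>x. f (a + x)) \<phi> \<le> weight ?l"
    by (rule covering_index_le) (use l in \<open>auto simp: t\<close>)
  then show "covering_index (\<lambda>x. f (a + x)) \<phi> \<le> weight l" by (simp only: w)
qed

lemma covering_index_left:
  assumes "Cc f"
  shows "covering_index (\<lambda>x. f (a + x)) \<phi> = covering_index f \<phi>"
proof (rule antisym[OF covering_index_left_le[OF assms]])
  have "covering_index f \<phi> = covering_index (\<lambda>x. f (a + (- a + x))) \<phi>"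
    by (simp add: add.assoc[symmetric])
  also have "\<dots> \<le> covering_index (\<lambda>x. f (a + x)) \<phi>"
    by (rule covering_index_left_le[OF Cc_left[OF assms]])
  finally show "covering_index f \<phi> \<le> covering_index (\<lambda>x. f (a + x)) \<phi>" .
qed

lemma covering_index_translate_combination:
  assumes \<psi>: "Cc \<psi>"
  shows "nonneg_weights l \<Longrightarrow> covering_index (translate_combination l \<psi>) \<phi> \<le> weight l * covering_index \<psi> \<phi>"
proof (induction l)
  case Nil
  have "translate_combination [] \<psi> = (\<lambda>x. 0)" by (rule ext) simp
  then show ?case by (simp add: covering_index_zero)
next
  case (Cons q l)
  obtain c s where q: "q = (c, s)" by force
  have c: "0 \<le> c" "nonneg_weights l" using Cons.prems q by auto
  have "translate_combination (q # l) \<psi> = (\<lambda>x. c * \<psi> (s + x) + translate_combination l \<psi> x)"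
    by (rule ext) (simp add: q)
  then have "covering_index (translate_combination (q # l) \<psi>) \<phi>
      \<le> covering_index (\<lambda>x. c * \<psi> (s + x)) \<phi> + covering_index (translate_combination l \<psi>) \<phi>"
    using covering_index_add[OF Cc_scale[OF c(1) Cc_left[OF \<psi>]] Cc_translate_combination[OF \<psi> c(2)], of s] by simp
  also have "covering_index (\<lambda>x. c * \<psi> (s + x)) \<phi> = c * covering_index \<psi> \<phi>"
    by (simp add: covering_index_scale[OF Cc_left[OF \<psi>] c(1)] covering_index_left[OF \<psi>])
  finally show ?case using Cons.IH[OF c(2)] q by (simp add: algebra_simps)
qed

end

section \<open>Existence of a left Haar functional\<close>

text \<open>
  Put \<open>h = f + g + d w\<close>, where \<open>w\<close> keeps \<open>h\<close> positive on the common support \<open>S\<close>, and write \<open>f = h f'\<close> and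
  \<open>g = h g'\<close>, so that \<open>f' + g' \<le> 1\<close>. A covering of \<open>h\<close> by translates of a sharply concentrated \<open>\<phi>\<close>
  splits into coverings of \<open>f\<close> and \<open>g\<close>: on a translate of the support of \<open>\<phi>\<close> the functions \<open>f'\<close> and \<open>g'\<close> are
  constant up to \<open>d\<close>, so the weights are multiplied by their values, and the total weight grows by
  at most the factor \<open>1 + 2 d\<close>.
\<close>

lemma covering_index_almost_additive:
  fixes f g :: "'a::{topological_group_add, t2_space} \<Rightarrow> real"
  assumes f: "Cc f" and g: "Cc g" and w: "Cc w" and d: "0 < d"
    and S: "compact S" "\<And>x. x \<notin> S \<Longrightarrow> f x + g x = 0" "\<And>x. x \<in> S \<Longrightarrow> 1 \<le> w x"
  obtains V where "open V" "0 \<in> V"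
    "\<And>\<phi> p. Cc \<phi> \<Longrightarrow> 0 < \<phi> p \<Longrightarrow> (\<And>x. x \<notin> V \<Longrightarrow> \<phi> x = 0) \<Longrightarrow>
       covering_index f \<phi> + covering_index g \<phi>
       \<le> (1 + 2 * d) * (covering_index (\<lambda>x. f x + g x) \<phi> + d * covering_index w \<phi>)"
proof -
  define h where "h = (\<lambda>x. f x + g x + d * w x)"
  have h: "Cc h" unfolding h_def using d by (intro Cc_add Cc_scale f g w) simp
  have h_pos: "0 < h x" if "x \<in> S" for x
  proof -
    have "0 < d * w x" using d S(3)[OF that] by simp
    then show ?thesis using Cc_nonneg[OF f, of x] Cc_nonneg[OF g, of x] by (simp add: h_def)
  qed
  have zero: "f x = 0" "g x = 0" if "x \<notin> S" for x
    using S(2)[OF that] Cc_nonneg[OF f, of x] Cc_nonneg[OF g, of x] by linarith+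
  define f' where "f' = (\<lambda>x. f x / h x)"
  define g' where "g' = (\<lambda>x. g x / h x)"
  have divide: "Cc (\<lambda>x. k x / h x)" if "Cc k" "\<And>x. x \<notin> S \<Longrightarrow> k x = 0" for k
    by (rule Cc_divide[OF that(1) S(1) that(2) Cc_continuous[OF h] Cc_nonneg[OF h] h_pos])
  have Cc': "Cc f'" "Cc g'"
    unfolding f'_def g'_def by (rule divide[OF f zero(1)] divide[OF g zero(2)]; assumption)+
  have sum_le: "f' x + g' x \<le> 1" for x
  proof (cases "x \<in> S")
    case True
    have "0 \<le> d * w x" using d Cc_nonneg[OF w] by simp
    then have "f x + g x \<le> h x" by (simp add: h_def)
    then show ?thesis using h_pos[OF True] by (simp add: f'_def g'_def add_divide_distrib[symmetric])
  qed (simp add: f'_def g'_def zero)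
  have eq: "f x = h x * f' x" "g x = h x * g' x" for x
    using h_pos[of x] zero[of x] by (cases "x \<in> S"; simp add: f'_def g'_def)+
  obtain V1 where V1: "open V1" "0 \<in> V1" "\<And>x y. - x + y \<in> V1 \<Longrightarrow> \<bar>f' x - f' y\<bar> < d"
    using Cc_left_uniform[OF Cc'(1) d] by metis
  obtain V2 where V2: "open V2" "0 \<in> V2" "\<And>x y. - x + y \<in> V2 \<Longrightarrow> \<bar>g' x - g' y\<bar> < d"
    using Cc_left_uniform[OF Cc'(2) d] by metis
  show ?thesis
  proof (rule that[of "V1 \<inter> V2"])
    show "open (V1 \<inter> V2)" "0 \<in> V1 \<inter> V2" using V1 V2 by auto
    fix \<phi> :: "'a \<Rightarrow> real" and p
    assume \<phi>: "Cc \<phi>" "0 < \<phi> p" and supp: "\<And>x. x \<notin> V1 \<inter> V2 \<Longrightarrow> \<phi> x = 0"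
    have localize: "covering_index k \<phi> \<le> (\<Sum>(c, s)\<leftarrow>l. c * (k' (- s) + d))"
      if l: "nonneg_weights l" "\<And>x. h x \<le> translate_combination l \<phi> x"
        and k: "Cc k'" "\<And>x. k x = h x * k' x" "\<And>x y. - x + y \<in> V1 \<inter> V2 \<Longrightarrow> \<bar>k' x - k' y\<bar> < d"
      for k k' l
    proof -
      let ?l = "map (\<lambda>(c, s). (c * (k' (- s) + d), s)) l"
      have "k x \<le> translate_combination ?l \<phi> x" for x
      proof -
        have "k x \<le> translate_combination l \<phi> x * k' x"
          unfolding k(2) by (intro mult_right_mono l(2) Cc_nonneg k(1))
        also have "\<dots> \<le> translate_combination ?l \<phi> x"
          using l(1)
        proof (induction l)
          case (Cons q l)
          obtain c s where q: "q = (c, s)" by force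
          have "\<phi> (s + x) * k' x \<le> \<phi> (s + x) * (k' (- s) + d)"
          \<comment> \<open>The translate of \<open>\<phi>\<close> by \<open>s\<close> is concentrated near \<open>- s\<close>.\<close>
          proof (cases "s + x \<in> V1 \<inter> V2")
            case True
            then have "k' x \<le> k' (- s) + d" using k(3)[of "- s" x] by auto
            then show ?thesis using Cc_nonneg[OF \<phi>(1)] by (intro mult_left_mono) auto
          qed (simp add: supp)
          then have "c * (\<phi> (s + x) * k' x) \<le> c * (\<phi> (s + x) * (k' (- s) + d))"
            by (rule mult_left_mono) (use Cons.prems q in auto)
          with Cons q show ?case by (auto simp: algebra_simps)
        qed simp
        finally show ?thesis .
      qed
      moreover have "nonneg_weights ?l"
      proof
        fix q assume "q \<in> set ?l"
        then obtain c s where cs: "(c, s) \<in> set l" "q = (c * (k' (- s) + d), s)" by auto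
        moreover have "0 \<le> k' (- s) + d" using Cc_nonneg[OF k(1), of "- s"] d by linarith
        moreover have "0 \<le> c" using l(1) cs(1) by auto
        ultimately show "0 \<le> fst q" by simp
      qed
      ultimately have "covering_index k \<phi> \<le> weight ?l"
        by (intro covering_index_le[OF \<phi>])
      also have "weight ?l = (\<Sum>(c, s)\<leftarrow>l. c * (k' (- s) + d))" by (induction l) auto
      finally show ?thesis .
    qed
    have "(covering_index f \<phi> + covering_index g \<phi>) / (1 + 2 * d) \<le> covering_index h \<phi>"
    proof (rule covering_index_greatest[OF \<phi> h])
      fix l assume l: "nonneg_weights l" "\<And>x. h x \<le> translate_combination l \<phi> x"
      have "covering_index f \<phi> + covering_index g \<phi>
          \<le> (\<Sum>(c, s)\<leftarrow>l. c * (f' (- s) + d)) + (\<Sum>(c, s)\<leftarrow>l. c * (g' (- s) + d))"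
        using localize[OF l Cc'(1) eq(1)] localize[OF l Cc'(2) eq(2)] V1(3) V2(3) by (intro add_mono) auto
      also have "\<dots> \<le> (1 + 2 * d) * weight l"
        using l(1)
      proof (induction l)
        case (Cons q l)
        obtain c s where q: "q = (c, s)" by force
        have "c * (f' (- s) + g' (- s)) \<le> c * 1"
          using Cons.prems q sum_le by (intro mult_left_mono) auto
        with Cons q show ?case by (auto simp: algebra_simps)
      qed simp
      finally show "(covering_index f \<phi> + covering_index g \<phi>) / (1 + 2 * d) \<le> weight l"
        using d by (simp add: pos_divide_le_eq mult.commute)
    qed
    also have "covering_index h \<phi> \<le> covering_index (\<lambda>x. f x + g x) \<phi> + d * covering_index w \<phi>"
      using covering_index_add[OF \<phi> Cc_add[OF f g] Cc_scale[OF _ w], of d] d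
        covering_index_scale[OF \<phi> w, of d]
      by (simp add: h_def)
    finally show "covering_index f \<phi> + covering_index g \<phi>
        \<le> (1 + 2 * d) * (covering_index (\<lambda>x. f x + g x) \<phi> + d * covering_index w \<phi>)"
      using d by (simp add: pos_divide_le_eq mult.commute)
  qed
qed

text \<open>
  Additivity and positive homogeneity on the cone of nonnegative functions suffice throughout, so the
  functional is not extended to signed functions.
\<close>

locale left_Haar =
  fixes I :: "('a::{topological_group_add, t2_space} \<Rightarrow> real) \<Rightarrow> real"
  assumes add: "Cc f \<Longrightarrow> Cc g \<Longrightarrow> I (\<lambda>x. f x + g x) = I f + I g"
    and scale: "0 \<le> c \<Longrightarrow> Cc f \<Longrightarrow> I (\<lambda>x. c * f x) = c * I f"
    and mono: "Cc f \<Longrightarrow> Cc g \<Longrightarrow> (\<And>x. f x \<le> g x) \<Longrightarrow> I f \<le> I g"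
    and left: "Cc f \<Longrightarrow> I (\<lambda>x. f (a + x)) = I f"
    and nontrivial: "\<exists>f. Cc f \<and> 0 < I f"

text \<open>
  The indices normalized at a fixed \<open>f0\<close> lie in the product of the intervals \<open>[0, B f]\<close>, which is
  compact by Tychonoff's theorem. Hence there is a cluster point \<open>I\<close> as \<open>\<phi>\<close> shrinks to \<open>0\<close>. Each required
  property is a closed condition that involves finitely many coordinates and holds for all indices, or, in the
  case of superadditivity up to \<open>e\<close>, for all sufficiently concentrated \<open>\<phi>\<close>, and so it passes to \<open>I\<close>.
\<close>

lemma left_Haar_exists:
  assumes lc: "locally_compact_space (euclidean :: 'a::{topological_group_add, t2_space} topology)"
  shows "\<exists>I :: ('a \<Rightarrow> real) \<Rightarrow> real. left_Haar I"
proof -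
  define \<N> where "\<N> = {V :: 'a set. open V \<and> 0 \<in> V}"
  define \<Phi> where "\<Phi> = (\<lambda>V. {\<phi> :: 'a \<Rightarrow> real. Cc \<phi> \<and> (\<exists>p. 0 < \<phi> p) \<and> (\<forall>x. x \<notin> V \<longrightarrow> \<phi> x = 0)})"
  have \<Phi>_ne: "\<exists>\<phi>. \<phi> \<in> \<Phi> V" if "V \<in> \<N>" for V
  proof -
    have V: "open V" "0 \<in> V" using that by (simp_all add: \<N>_def)
    obtain u :: "'a \<Rightarrow> real" where u: "Cc u" "\<And>x. u x \<le> 1" "u 0 = 1" "\<And>x. x \<notin> V \<Longrightarrow> u x = 0"
      by (rule Cc_bump_exists[OF lc V]) (rule that; assumption)
    have "0 < u 0" using u(3) by simp
    then have "u \<in> \<Phi> V" unfolding \<Phi>_def using u(1,4) by blast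
    then show ?thesis by blast
  qed
  obtain f0 where "f0 \<in> \<Phi> UNIV" using \<Phi>_ne[of UNIV] by (auto simp: \<N>_def)
  then obtain q where f0: "Cc f0" "0 < f0 q" by (auto simp: \<Phi>_def)
  have "\<exists>l. nonneg_weights l \<and> (\<forall>x. f x \<le> translate_combination l f0 x)" if "Cc f" for f
    by (rule Cc_le_translate_combination[OF that f0]) blast
  then obtain L where L: "\<And>f. Cc f \<Longrightarrow> nonneg_weights (L f)"
    "\<And>f x. Cc f \<Longrightarrow> f x \<le> translate_combination (L f) f0 x" by metis
  define B where "B = (\<lambda>f. if Cc f then weight (L f) else 0)"
  define J where "J = (\<lambda>\<phi> f. if Cc f then covering_index f \<phi> / covering_index f0 \<phi> else 0)"
  have index_pos: "0 < covering_index f0 \<phi>" if "\<phi> \<in> \<Phi> V" for \<phi> V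
    using that covering_index_pos[OF _ _ f0] by (auto simp: \<Phi>_def)
  have J_nonneg: "0 \<le> J \<phi> f" if "\<phi> \<in> \<Phi> V" for \<phi> V f
    using that index_pos[OF that] covering_index_nonneg[of \<phi>]
    by (auto simp: J_def \<Phi>_def intro!: divide_nonneg_pos)
  have J_le: "J \<phi> f \<le> B f" if \<phi>: "\<phi> \<in> \<Phi> V" for \<phi> V f
  proof (cases "Cc f")
    case True
    from \<phi> obtain p where p: "Cc \<phi>" "0 < \<phi> p" by (auto simp: \<Phi>_def)
    have "covering_index f \<phi> \<le> covering_index (translate_combination (L f) f0) \<phi>"
      by (rule covering_index_mono[OF p Cc_translate_combination[OF f0(1) L(1)[OF True]] L(2)[OF True]])
    also have "\<dots> \<le> weight (L f) * covering_index f0 \<phi>"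
      by (rule covering_index_translate_combination[OF p f0(1) L(1)[OF True]])
    finally show ?thesis using True index_pos[OF \<phi>] by (simp add: J_def B_def pos_divide_le_eq)
  qed (simp add: J_def B_def)
  define K where "K = (\<Pi>\<^sub>E f\<in>UNIV. {0..B f})"
  have "compactin (product_topology (\<lambda>_. euclideanreal) UNIV) K"
    unfolding K_def compactin_PiE by simp
  then have K: "compact K" by (simp add: euclidean_product_topology)
  have JK: "J \<phi> \<in> K" if "\<phi> \<in> \<Phi> V" for \<phi> V
    using J_nonneg[OF that] J_le[OF that] by (auto simp: K_def)
  have "K \<inter> (\<Inter>V\<in>\<N>. closure (J ` \<Phi> V)) \<noteq> {}"
  proof (rule compact_imp_fip_image[OF K])
    fix \<V> assume \<V>: "finite \<V>" "\<V> \<subseteq> \<N>"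
    then have "\<Inter> \<V> \<in> \<N>" by (auto simp: \<N>_def intro!: open_Inter)
    then obtain \<phi> where \<phi>: "\<phi> \<in> \<Phi> (\<Inter> \<V>)" using \<Phi>_ne by blast
    then have "\<phi> \<in> \<Phi> V" if "V \<in> \<V>" for V using that unfolding \<Phi>_def by blast
    then have "J \<phi> \<in> (\<Inter>V\<in>\<V>. closure (J ` \<Phi> V))" using closure_subset by blast
    then show "K \<inter> (\<Inter>V\<in>\<V>. closure (J ` \<Phi> V)) \<noteq> {}" using JK[OF \<phi>] by blast
  qed simp
  then obtain I where I: "\<And>V. V \<in> \<N> \<Longrightarrow> I \<in> closure (J ` \<Phi> V)" by blast
  have limit: "I \<in> C" if "closed C" "V \<in> \<N>" "\<And>\<phi>. \<phi> \<in> \<Phi> V \<Longrightarrow> J \<phi> \<in> C" for C V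
  proof -
    have "closure (J ` \<Phi> V) \<subseteq> C" by (rule closure_minimal) (use that in auto)
    then show ?thesis using I[OF that(2)] by blast
  qed
  have UNIV_N: "UNIV \<in> \<N>" by (simp add: \<N>_def)
  have coord: "continuous_on UNIV (\<lambda>I :: ('a \<Rightarrow> real) \<Rightarrow> real. I f)" for f
    by simp
  have "left_Haar I"
  proof
    fix f g :: "'a \<Rightarrow> real" and c :: real and a :: 'a
    show "\<exists>f. Cc f \<and> 0 < I f"
    proof -
      have "I \<in> {I. I f0 = 1}"
      proof (rule limit[OF _ UNIV_N])
        show "closed {I :: ('a \<Rightarrow> real) \<Rightarrow> real. I f0 = 1}"
          by (intro closed_Collect_eq coord continuous_intros)
        show "J \<phi> \<in> {I. I f0 = 1}" if "\<phi> \<in> \<Phi> UNIV" for \<phi>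
          using index_pos[OF that] f0(1) by (simp add: J_def)
      qed
      then show ?thesis using f0(1) by force
    qed
    assume f: "Cc f"
    show "I (\<lambda>x. f (a + x)) = I f"
    proof -
      have "I \<in> {I. I (\<lambda>x. f (a + x)) = I f}"
      proof (rule limit[OF _ UNIV_N])
        show "closed {I :: ('a \<Rightarrow> real) \<Rightarrow> real. I (\<lambda>x. f (a + x)) = I f}"
          by (intro closed_Collect_eq coord)
        show "J \<phi> \<in> {I. I (\<lambda>x. f (a + x)) = I f}" if "\<phi> \<in> \<Phi> UNIV" for \<phi>
          using that covering_index_left[of \<phi> _ f a] f Cc_left[OF f, of a] by (auto simp: J_def \<Phi>_def)
      qed
      then show ?thesis by simp
    qed
    show "I (\<lambda>x. c * f x) = c * I f" if c: "0 \<le> c"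
    proof -
      have "I \<in> {I. I (\<lambda>x. c * f x) = c * I f}"
      proof (rule limit[OF _ UNIV_N])
        show "closed {I :: ('a \<Rightarrow> real) \<Rightarrow> real. I (\<lambda>x. c * f x) = c * I f}"
          by (intro closed_Collect_eq coord continuous_on_mult continuous_on_const)
        show "J \<phi> \<in> {I. I (\<lambda>x. c * f x) = c * I f}" if "\<phi> \<in> \<Phi> UNIV" for \<phi>
          using that covering_index_scale[of \<phi> _ f c] f Cc_scale[OF c f] c by (auto simp: J_def \<Phi>_def)
      qed
      then show ?thesis by simp
    qed
    assume g: "Cc g"
    show "I f \<le> I g" if fg: "\<And>x. f x \<le> g x"
    proof -
      have "I \<in> {I. I f \<le> I g}"
      proof (rule limit[OF _ UNIV_N])
        show "closed {I :: ('a \<Rightarrow> real) \<Rightarrow> real. I f \<le> I g}"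
          by (intro closed_Collect_le coord)
        show "J \<phi> \<in> {I. I f \<le> I g}" if "\<phi> \<in> \<Phi> UNIV" for \<phi>
          using that covering_index_mono[of \<phi> _ g f] f g fg index_pos[OF that]
          by (auto simp: J_def \<Phi>_def intro!: divide_right_mono)
      qed
      then show ?thesis by simp
    qed
    have fg: "Cc (\<lambda>x. f x + g x)" by (rule Cc_add[OF f g])
    have "I (\<lambda>x. f x + g x) \<le> I f + I g"
    proof -
      have "I \<in> {I. I (\<lambda>x. f x + g x) \<le> I f + I g}"
      proof (rule limit[OF _ UNIV_N])
        show "closed {I :: ('a \<Rightarrow> real) \<Rightarrow> real. I (\<lambda>x. f x + g x) \<le> I f + I g}"
          by (intro closed_Collect_le coord continuous_on_add)
        show "J \<phi> \<in> {I. I (\<lambda>x. f x + g x) \<le> I f + I g}" if "\<phi> \<in> \<Phi> UNIV" for \<phi>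
          using that covering_index_add[of \<phi> _ f g] f g fg index_pos[OF that]
          by (auto simp: J_def \<Phi>_def add_divide_distrib[symmetric] intro!: divide_right_mono)
      qed
      then show ?thesis by simp
    qed
    moreover have "I f + I g \<le> I (\<lambda>x. f x + g x) + e" if e: "0 < e" for e
    proof -
      let ?h = "\<lambda>x. f x + g x"
      obtain S where S: "compact S" "\<And>x. x \<notin> S \<Longrightarrow> ?h x = 0"
        by (rule Cc_support[OF fg]) (rule that; assumption)
      obtain l where l: "nonneg_weights l" "\<And>x. x \<in> S \<Longrightarrow> 1 \<le> translate_combination l f0 x"
        by (rule translate_combination_dominates[OF S(1) f0 zero_le_one]) (rule that; assumption)
      define w where "w = translate_combination l f0"
      have w: "Cc w" unfolding w_def by (rule Cc_translate_combination[OF f0(1) l(1)])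
      have B: "0 \<le> B ?h" "0 \<le> B w" 
        using weight_nonneg[OF L(1)[OF fg]] weight_nonneg[OF L(1)[OF w]] fg w by (simp_all add: B_def)
      \<comment> \<open>With \<open>d \<le> 1\<close> the excess in the almost additivity is at most \<open>d (2 B h + 3 B w)\<close>.\<close>
      define d where "d = min 1 (e / (2 * B ?h + 3 * B w + 1))"
      have d: "0 < d" "d \<le> 1" "d * (2 * B ?h + 3 * B w) \<le> e"
      proof -
        show "0 < d" "d \<le> 1" using e B by (auto simp: d_def)
        have "d * (2 * B ?h + 3 * B w) \<le> d * (2 * B ?h + 3 * B w + 1)"
          using \<open>0 < d\<close> by simp
        also have "\<dots> \<le> e / (2 * B ?h + 3 * B w + 1) * (2 * B ?h + 3 * B w + 1)"
          using B by (intro mult_right_mono) (auto simp: d_def)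
        also have "\<dots> = e" using B by simp
        finally show "d * (2 * B ?h + 3 * B w) \<le> e" .
      qed
      have w1: "1 \<le> w x" if "x \<in> S" for x using l(2)[OF that] by (simp add: w_def)
      obtain V where V: "open V" "0 \<in> V" "\<And>\<phi> p. Cc \<phi> \<Longrightarrow> 0 < \<phi> p \<Longrightarrow> (\<And>x. x \<notin> V \<Longrightarrow> \<phi> x = 0) \<Longrightarrow>
         covering_index f \<phi> + covering_index g \<phi>
         \<le> (1 + 2 * d) * (covering_index ?h \<phi> + d * covering_index w \<phi>)"
        using covering_index_almost_additive[OF f g w d(1) S w1] by metis
      have "I \<in> {I. I f + I g \<le> I ?h + e}"
      proof (rule limit)
        show "V \<in> \<N>" using V(1,2) by (simp add: \<N>_def)
        show "closed {I :: ('a \<Rightarrow> real) \<Rightarrow> real. I f + I g \<le> I ?h + e}"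
          by (intro closed_Collect_le coord continuous_on_add continuous_on_const)
        fix \<phi> assume \<phi>: "\<phi> \<in> \<Phi> V"
        then obtain p where "Cc \<phi>" "0 < \<phi> p" "\<And>x. x \<notin> V \<Longrightarrow> \<phi> x = 0" by (auto simp: \<Phi>_def)
        from V(3)[OF this] index_pos[OF \<phi>]
        have "(covering_index f \<phi> + covering_index g \<phi>) / covering_index f0 \<phi>
            \<le> ((1 + 2 * d) * (covering_index ?h \<phi> + d * covering_index w \<phi>)) / covering_index f0 \<phi>"
          by (intro divide_right_mono) auto
        then have "J \<phi> f + J \<phi> g \<le> (1 + 2 * d) * (J \<phi> ?h + d * J \<phi> w)"
          using f g fg w by (simp add: J_def add_divide_distrib algebra_simps)
        also have "\<dots> = J \<phi> ?h + d * (2 * J \<phi> ?h + (1 + 2 * d) * J \<phi> w)" by (simp add: algebra_simps)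
        also have "\<dots> \<le> J \<phi> ?h + d * (2 * B ?h + 3 * B w)"
          using d(1,2) J_le[OF \<phi>] J_nonneg[OF \<phi>]
          by (intro add_left_mono mult_left_mono add_mono mult_mono) auto
        also have "\<dots> \<le> J \<phi> ?h + e" using d(3) by simp
        finally show "J \<phi> \<in> {I. I f + I g \<le> I ?h + e}" by simp
      qed
      then show ?thesis by simp
    qed
    then have "I f + I g \<le> I (\<lambda>x. f x + g x)" by (rule field_le_epsilon)
    ultimately show "I (\<lambda>x. f x + g x) = I f + I g" by (rule antisym)
  qed
  then show ?thesis by blast
qed

section \<open>Uniqueness of the left Haar functional\<close>

context left_Haar
begin

lemma zero: "I (\<lambda>x. 0) = 0"
  using scale[of 0 "\<lambda>x. 0"] by simp

lemma nonneg: "Cc f \<Longrightarrow> 0 \<le> I f"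
  using mono[OF Cc_zero, of f] zero Cc_nonneg[of f] by simp

lemma sum: "finite A \<Longrightarrow> (\<And>i. i \<in> A \<Longrightarrow> Cc (f i)) \<Longrightarrow> I (\<lambda>x. \<Sum>i\<in>A. f i x) = (\<Sum>i\<in>A. I (f i))"
proof (induction A rule: finite_induct)
  case (insert i A)
  then show ?case using add[of "f i" "\<lambda>x. \<Sum>i\<in>A. f i x"] Cc_sum[of A f] by simp
qed (simp add: zero)

lemma translate_combination:
  assumes "Cc \<phi>"
  shows "nonneg_weights l \<Longrightarrow> I (translate_combination l \<phi>) = weight l * I \<phi>"
proof (induction l)
  case Nil
  have "translate_combination [] \<phi> = (\<lambda>x. 0)" by (rule ext) simp
  then show ?case by (simp add: zero)
next
  case (Cons p l)
  obtain c s where p: "p = (c, s)" by force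
  have c: "0 \<le> c" "nonneg_weights l" using Cons.prems p by auto
  have eq: "translate_combination (p # l) \<phi> = (\<lambda>x. c * \<phi> (s + x) + translate_combination l \<phi> x)"
    by (rule ext) (simp add: p)
  have "I (translate_combination (p # l) \<phi>) = c * I \<phi> + weight l * I \<phi>"
    unfolding eq using Cons.IH[OF c(2)] add[OF Cc_scale[OF c(1) Cc_left[OF assms]] Cc_translate_combination[OF assms c(2)]]
      scale[OF c(1) Cc_left[OF assms]] left[OF assms] by simp
  moreover have "weight (p # l) = c + weight l" by (simp add: p)
  ultimately show ?case by (simp only: distrib_right)
qed

lemma pos:
  assumes "Cc f" "0 < f q"
  shows "0 < I f"
proof -
  obtain f0 where f0: "Cc f0" "0 < I f0" using nontrivial by blast
  obtain l where l: "nonneg_weights l" "\<And>x. f0 x \<le> translate_combination l f x"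
    by (rule Cc_le_translate_combination[OF f0(1) assms]) (rule that; assumption)
  have "I f0 \<le> weight l * I f"
    using mono[OF f0(1) Cc_translate_combination[OF assms(1) l(1)] l(2)]
    by (simp add: translate_combination[OF assms(1) l(1)])
  with f0(2) nonneg[OF assms(1)] show ?thesis by (cases "I f = 0") auto
qed

lemma compact_majorant:
  fixes S :: "'a set"
  assumes "compact S"
  obtains w where "Cc w" "\<And>x. x \<in> S \<Longrightarrow> 1 \<le> w x"
proof -
  obtain f0 where f0: "Cc f0" "0 < I f0" using nontrivial by blast
  have "\<exists>q. 0 < f0 q"
  proof (rule ccontr)
    assume neg: "\<nexists>q. 0 < f0 q"
    have "f0 x = 0" for x
      using neg Cc_nonneg[OF f0(1), of x] by (auto simp: not_less intro: antisym)
    then have "f0 = (\<lambda>x. 0)" by (rule ext)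
    with zero f0(2) show False by simp
  qed
  then obtain q where q: "0 < f0 q" by blast
  obtain l where l: "nonneg_weights l" "\<And>x. x \<in> S \<Longrightarrow> 1 \<le> translate_combination l f0 x"
    by (rule translate_combination_dominates[OF assms f0(1) q zero_le_one]) (rule that; assumption)
  show ?thesis by (rule that[OF Cc_translate_combination[OF f0(1) l(1)] l(2)])
qed

end

text \<open>
  Convolving \<open>f\<close> with a function \<open>g\<close> concentrated at \<open>0\<close> reproduces \<open>f\<close> up to \<open>\<delta>\<close> and the factor
  \<open>\<gamma> = I (\<lambda>x. g (- x))\<close>. With a partition of \<open>f\<close> into pieces \<open>k s\<close> of small support, the convolution is
  approximately \<open>\<Sum>s. I (k s) * g (- s + x)\<close>, a combination of left translates of \<open>g\<close> of total weight \<open>I f\<close>, to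
  which \<open>J\<close> assigns \<open>I f * J g\<close>. Replacing the convolution by this finite sum avoids interchanging \<open>I\<close>
  and \<open>J\<close>.
\<close>

lemma left_Haar_compare:
  fixes f :: "'a::{topological_group_add, t2_space} \<Rightarrow> real"
  assumes lc: "locally_compact_space (euclidean :: 'a topology)"
    and "left_Haar I" "left_Haar J" and f: "Cc f" and e: "0 < e"
  shows "\<exists>V. open V \<and> 0 \<in> V \<and> (\<forall>g p. Cc g \<longrightarrow> 0 < g p \<longrightarrow> (\<forall>x. x \<notin> V \<longrightarrow> g x = 0) \<longrightarrow>
    J f * I (\<lambda>x. g (- x)) \<le> I f * J g + e * I (\<lambda>x. g (- x)))"
proof -
  interpret I: left_Haar I by fact
  interpret J: left_Haar J by fact
  obtain S where S: "compact S" "\<And>x. x \<notin> S \<Longrightarrow> f x = 0"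
    by (rule Cc_support[OF f]) (rule that; assumption)
  obtain w where w: "Cc w" "\<And>x. x \<in> S \<Longrightarrow> 1 \<le> w x"
    by (rule J.compact_majorant[OF S(1)]) (rule that; assumption)
  define M where "M = J w"
  have M: "0 \<le> M" unfolding M_def by (rule J.nonneg[OF w(1)])
  define \<delta> where "\<delta> = e / (2 * (M + 1))"
  have \<delta>: "0 < \<delta>" using e M by (simp add: \<delta>_def)
  have \<delta>M: "\<delta> * M \<le> e / 2"
  proof -
    have "\<delta> * M \<le> \<delta> * (M + 1)" using \<delta> by simp
    also have "\<dots> = e / 2" using M by (simp add: \<delta>_def field_simps)
    finally show ?thesis .
  qed
  obtain V where V: "open V" "0 \<in> V" "\<And>x y. - x + y \<in> V \<Longrightarrow> \<bar>f x - f y\<bar> < \<delta>"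
    using Cc_left_uniform[OF f \<delta>] by metis
  have "J f * I (\<lambda>x. g (- x)) \<le> I f * J g + e * I (\<lambda>x. g (- x))"
    if g: "Cc g" "0 < g p" and supp: "\<And>x. x \<notin> V \<Longrightarrow> g x = 0" for g p
  proof -
    define g' where "g' = (\<lambda>x. g (- x))"
    have g': "Cc g'" unfolding g'_def by (rule Cc_uminus[OF g(1)])
    define \<gamma> where "\<gamma> = I g'"
    have \<gamma>: "0 < \<gamma>" unfolding \<gamma>_def by (rule I.pos[OF g', of "- p"]) (simp add: g'_def g)
    have If: "0 \<le> I f" by (rule I.nonneg[OF f])
    \<comment> \<open>The oscillation \<open>\<eta>\<close> of \<open>g\<close> may depend on \<open>g\<close>; it contributes at most half of the error, and \<open>\<delta>\<close> the
        other half.\<close>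
    define \<eta> where "\<eta> = e * \<gamma> / (2 * (I f * M + 1))"
    have IfM: "0 \<le> I f * M" using If M by simp
    have \<eta>: "0 < \<eta>" unfolding \<eta>_def using e \<gamma> IfM by (intro divide_pos_pos mult_pos_pos) auto
    have \<eta>M: "\<eta> * I f * M \<le> e * \<gamma> / 2"
    proof -
      have "\<eta> * I f * M \<le> \<eta> * (I f * M + 1)" using \<eta> by (simp add: algebra_simps)
      also have "\<dots> = e * \<gamma> / 2" unfolding \<eta>_def using IfM by (simp add: field_simps)
      finally show ?thesis .
    qed
    obtain V' where V': "open V'" "0 \<in> V'" "\<And>x y. x - y \<in> V' \<Longrightarrow> \<bar>g x - g y\<bar> < \<eta>"
      using Cc_right_uniform[OF g(1) \<eta>] by metis
    obtain b where b: "Cc b" "\<And>x. b x \<le> 1" "b 0 = 1" "\<And>x. x \<notin> V' \<Longrightarrow> b x = 0"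
      by (rule Cc_bump_exists[OF lc V'(1,2)]) (rule that; assumption)
    \<comment> \<open>A partition of \<open>f\<close> into pieces supported in left translates of \<open>V'\<close>.\<close>
    have "open ((\<lambda>y. b (- s + y)) -` {0<..})" for s
      by (intro open_vimage open_greaterThan Cc_continuous Cc_left b(1))
    moreover have "S \<subseteq> (\<Union>s\<in>S. (\<lambda>y. b (- s + y)) -` {0<..})" using b(3) by force
    ultimately obtain T where T: "T \<subseteq> S" "finite T" "S \<subseteq> (\<Union>s\<in>T. (\<lambda>y. b (- s + y)) -` {0<..})"
      using compactE_image[OF S(1), of S "\<lambda>s. (\<lambda>y. b (- s + y)) -` {0<..}"] by metis
    define B where "B = (\<lambda>y. \<Sum>s\<in>T. b (- s + y))"
    have B: "Cc B" unfolding B_def by (intro Cc_sum T(2) Cc_left b(1))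
    have B_pos: "0 < B y" if "y \<in> S" for y
    proof -
      have "y \<in> (\<Union>s\<in>T. (\<lambda>y. b (- s + y)) -` {0<..})" using that T(3) by blast
      then obtain s where s: "s \<in> T" "0 < b (- s + y)" by auto
      then show ?thesis unfolding B_def using T(2) Cc_nonneg[OF b(1)] by (intro sum_pos2[of T s]) auto
    qed
    define k where "k = (\<lambda>s y. b (- s + y) * (f y / B y))"
    have "Cc (\<lambda>y. f y / B y)"
      by (rule Cc_divide[OF f S Cc_continuous[OF B] Cc_nonneg[OF B] B_pos])
    then have k: "Cc (k s)" for s
      unfolding k_def using Cc_left[OF b(1)] by (intro Cc_mult Cc_continuous) (auto simp: Cc_nonneg[OF b(1)])
    have k_sum: "(\<Sum>s\<in>T. k s y) = f y" for y
    proof (cases "y \<in> S")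
      case True
      have "(\<Sum>s\<in>T. k s y) = B y * (f y / B y)"
        unfolding k_def B_def by (simp only: sum_distrib_right)
      then show ?thesis using B_pos[OF True] by simp
    qed (simp add: k_def S(2))
    have k_zero: "k s y = 0" if "- s + y \<notin> V'" for s y using b(4)[OF that] by (simp add: k_def)
    have pointwise: "f x * g (- y + x) \<le> (\<Sum>s\<in>T. g (- s + x) * k s y) + \<eta> * f y + \<delta> * g (- y + x)" for x y
    proof -
      have "f x * g (- y + x) \<le> (f y + \<delta>) * g (- y + x)"
      proof (cases "- y + x \<in> V")
        case True
        then have "f x \<le> f y + \<delta>" using V(3)[of y x] by linarith
        then show ?thesis by (intro mult_right_mono Cc_nonneg g(1))
      qed (simp add: supp)
      also have "\<dots> = (\<Sum>s\<in>T. k s y * g (- y + x)) + \<delta> * g (- y + x)"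
        by (simp only: distrib_right sum_distrib_right[symmetric] k_sum)
      also have "(\<Sum>s\<in>T. k s y * g (- y + x)) \<le> (\<Sum>s\<in>T. k s y * (g (- s + x) + \<eta>))"
      proof (rule sum_mono)
        fix s
        show "k s y * g (- y + x) \<le> k s y * (g (- s + x) + \<eta>)"
        proof (cases "- s + y \<in> V'")
          case True
          have "(- s + x) - (- y + x) = - s + y" by (simp only: group_normalize)
          then have "\<bar>g (- s + x) - g (- y + x)\<bar> < \<eta>" using V'(3) True by metis
          then have "g (- y + x) \<le> g (- s + x) + \<eta>" by linarith
          then show ?thesis by (intro mult_left_mono Cc_nonneg k)
        qed (simp add: k_zero)
      qed
      also have "\<dots> = (\<Sum>s\<in>T. g (- s + x) * k s y) + \<eta> * f y"
        by (simp add: distrib_left sum.distrib sum_distrib_left[symmetric] k_sum mult.commute)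
      finally show ?thesis by simp
    qed
    have integrated: "f x * \<gamma> \<le> (\<Sum>s\<in>T. I (k s) * g (- s + x)) + (\<eta> * I f + \<delta> * \<gamma>)" for x
    proof -
      define r where "r = (\<lambda>y. g (- y + x))"
      have r_eq: "r = (\<lambda>y. g' (- x + y))" by (rule ext) (simp add: r_def g'_def minus_add)
      have r: "Cc r" "I r = \<gamma>"
        unfolding r_eq \<gamma>_def by (rule Cc_left[OF g'], rule I.left[OF g'])
      have gs: "0 \<le> g (- s + x)" for s by (rule Cc_nonneg[OF g(1)])
      have c1: "Cc (\<lambda>y. \<Sum>s\<in>T. g (- s + x) * k s y)"
        by (intro Cc_sum T(2) Cc_scale gs k)
      have c2: "Cc (\<lambda>y. \<eta> * f y)" "Cc (\<lambda>y. \<delta> * r y)"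
        using \<eta> \<delta> by (intro Cc_scale f r(1); simp)+
      have "f x * \<gamma> = I (\<lambda>y. f x * r y)"
        using I.scale[OF Cc_nonneg[OF f] r(1)] r(2) by simp
      also have "\<dots> \<le> I (\<lambda>y. (\<Sum>s\<in>T. g (- s + x) * k s y) + \<eta> * f y + \<delta> * r y)"
        using pointwise unfolding r_def[symmetric]
        by (intro I.mono Cc_add c1 c2 Cc_scale Cc_nonneg f r(1)) (simp add: r_def)
      also have "\<dots> = I (\<lambda>y. \<Sum>s\<in>T. g (- s + x) * k s y) + I (\<lambda>y. \<eta> * f y) + I (\<lambda>y. \<delta> * r y)"
        by (simp add: I.add Cc_add c1 c2)
      also have "I (\<lambda>y. \<Sum>s\<in>T. g (- s + x) * k s y) = (\<Sum>s\<in>T. I (k s) * g (- s + x))"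
        using I.sum[OF T(2), of "\<lambda>s y. g (- s + x) * k s y"] I.scale[OF gs k] Cc_scale[OF gs k]
        by (simp add: mult.commute)
      also have "I (\<lambda>y. \<eta> * f y) = \<eta> * I f" using \<eta> f by (intro I.scale) auto
      also have "I (\<lambda>y. \<delta> * r y) = \<delta> * \<gamma>" using \<delta> r by (subst I.scale) auto
      finally show ?thesis by simp
    qed
    define c where "c = \<eta> * I f + \<delta> * \<gamma>"
    have c: "0 \<le> c" using \<eta> \<delta> \<gamma> If by (simp add: c_def)
    have Ik: "0 \<le> I (k s)" for s by (rule I.nonneg[OF k])
    have d1: "Cc (\<lambda>x. \<Sum>s\<in>T. I (k s) * g (- s + x))"
      by (intro Cc_sum T(2) Cc_scale Ik Cc_left g(1))
    have d2: "Cc (\<lambda>x. c * w x)" by (rule Cc_scale[OF c w(1)])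
    have "\<gamma> * J f = J (\<lambda>x. \<gamma> * f x)" using \<gamma> f by (subst J.scale) auto
    also have "\<dots> \<le> J (\<lambda>x. (\<Sum>s\<in>T. I (k s) * g (- s + x)) + c * w x)"
    proof (rule J.mono)
      show "Cc (\<lambda>x. \<gamma> * f x)" using \<gamma> f by (intro Cc_scale) auto
      show "Cc (\<lambda>x. (\<Sum>s\<in>T. I (k s) * g (- s + x)) + c * w x)" by (rule Cc_add[OF d1 d2])
      show "\<gamma> * f x \<le> (\<Sum>s\<in>T. I (k s) * g (- s + x)) + c * w x" for x
      proof (cases "x \<in> S")
        case True
        have "c \<le> c * w x" using c w(2)[OF True] by (simp add: mult_le_cancel_left1)
        then show ?thesis using integrated[of x] by (simp add: c_def mult.commute)
      next
        case False
        then show ?thesis using S(2)[OF False] Cc_nonneg[OF d1, of x] Cc_nonneg[OF d2, of x] by simp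
      qed
    qed
    also have "\<dots> = J (\<lambda>x. \<Sum>s\<in>T. I (k s) * g (- s + x)) + J (\<lambda>x. c * w x)" by (rule J.add[OF d1 d2])
    also have "J (\<lambda>x. \<Sum>s\<in>T. I (k s) * g (- s + x)) = (\<Sum>s\<in>T. I (k s) * J g)"
      using J.sum[OF T(2), of "\<lambda>s x. I (k s) * g (- s + x)"] J.scale[OF Ik Cc_left[OF g(1)]]
        Cc_scale[OF Ik Cc_left[OF g(1)]] J.left[OF g(1)] by simp
    also have "\<dots> = I f * J g"
      using I.sum[OF T(2), of k] k k_sum by (simp add: sum_distrib_right)
    also have "J (\<lambda>x. c * w x) = c * M" unfolding M_def by (rule J.scale[OF c w(1)])
    also have "c * M \<le> e * \<gamma>"
    proof -
      have "c * M = \<eta> * I f * M + (\<delta> * M) * \<gamma>" by (simp add: c_def algebra_simps)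
      also have "\<dots> \<le> e * \<gamma> / 2 + e / 2 * \<gamma>"
        using \<gamma> by (intro add_mono \<eta>M mult_right_mono \<delta>M) auto
      finally show ?thesis by (simp add: mult.commute)
    qed
    finally show ?thesis by (simp add: \<gamma>_def g'_def mult.commute)
  qed
  with V(1,2) show ?thesis by blast
qed

text \<open>
  For a symmetric concentrated \<open>h\<close>, the comparison bounds \<open>J f / I f\<close> above by the ratio \<open>r = J h / I h\<close>,
  and with the roles of \<open>I\<close> and \<open>J\<close> exchanged it bounds \<open>I g / J g\<close> above by \<open>1 / r\<close>, up to errors of
  order \<open>e\<close>. The bound \<open>r \<le> R\<close>, with \<open>R\<close> independent of \<open>e\<close>, keeps the errors under control in the product.
\<close>

lemma left_Haar_ratio_le:
  fixes f g :: "'a::{topological_group_add, t2_space} \<Rightarrow> real"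
  assumes lc: "locally_compact_space (euclidean :: 'a topology)"
    and I: "left_Haar I" and J: "left_Haar J" and f: "Cc f" and g: "Cc g"
  shows "J f * I g \<le> I f * J g"
proof -
  interpret I: left_Haar I by fact
  interpret J: left_Haar J by fact
  have nn: "0 \<le> I f" "0 \<le> I g" "0 \<le> J f" "0 \<le> J g"
    using f g by (auto intro: I.nonneg J.nonneg)
  show ?thesis
  proof (cases "I g = 0")
    case True
    then show ?thesis using nn by simp
  next
    case False
    with nn have Ig: "0 < I g" by simp
    define R where "R = 2 * J g / I g"
    define D where "D = R * I f + I g + 1"
    have R: "0 \<le> R" using nn by (simp add: R_def)
    have D: "0 < D" using R nn by (simp add: D_def add_nonneg_pos)
    show ?thesis
    proof (rule field_le_epsilon)
      fix \<epsilon> :: real assume \<epsilon>: "0 < \<epsilon>"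
      define e where "e = min (I g / 2) (\<epsilon> / D)"
      have e: "0 < e" using Ig \<epsilon> D by (simp add: e_def)
      have e2: "e \<le> I g / 2" unfolding e_def by (rule min.cobounded1)
      have "e \<le> \<epsilon> / D" by (simp add: e_def)
      then have eD: "e * D \<le> \<epsilon>" using D by (simp add: pos_le_divide_eq)
      obtain V1 where V1: "open V1" "0 \<in> V1" "\<And>h p. Cc h \<Longrightarrow> 0 < h p \<Longrightarrow> (\<forall>x. x \<notin> V1 \<longrightarrow> h x = 0) \<Longrightarrow>
          J f * I (\<lambda>x. h (- x)) \<le> I f * J h + e * I (\<lambda>x. h (- x))"
        using left_Haar_compare[OF lc I J f e] by blast
      obtain V2 where V2: "open V2" "0 \<in> V2" "\<And>h p. Cc h \<Longrightarrow> 0 < h p \<Longrightarrow> (\<forall>x. x \<notin> V2 \<longrightarrow> h x = 0) \<Longrightarrow>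
          I g * J (\<lambda>x. h (- x)) \<le> J g * I h + e * J (\<lambda>x. h (- x))"
        using left_Haar_compare[OF lc J I g e] by blast
      define V where "V = (V1 \<inter> V2) \<inter> uminus -` (V1 \<inter> V2)"
      have V: "open V" "0 \<in> V"
        unfolding V_def using V1 V2 by (auto intro!: open_Int open_vimage continuous_intros)
      obtain b where b: "Cc b" "\<And>x. b x \<le> 1" "b 0 = 1" "\<And>x. x \<notin> V \<Longrightarrow> b x = 0"
        by (rule Cc_bump_exists[OF lc V]) (rule that; assumption)
      define h where "h = (\<lambda>x. b x + b (- x))"
      have h: "Cc h" "0 < h 0" unfolding h_def using b by (auto intro: Cc_add Cc_uminus)
      have h_sym: "(\<lambda>x. h (- x)) = h" by (rule ext) (simp add: h_def)
      have h_supp: "h x = 0" if "x \<notin> V" for x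
      proof -
        have "- x \<notin> V" using that by (auto simp: V_def)
        then show ?thesis using that b(4) by (simp add: h_def)
      qed
      have *: "J f * I h \<le> I f * J h + e * I h"
        using V1(3)[OF h] h_supp unfolding h_sym by (auto simp: V_def)
      have **: "I g * J h \<le> J g * I h + e * J h"
        using V2(3)[OF h] h_supp unfolding h_sym by (auto simp: V_def)
      have Ih: "0 < I h" "0 < J h" by (rule I.pos[OF h], rule J.pos[OF h])
      define r where "r = J h / I h"
      have r: "0 < r" using Ih by (simp add: r_def)
      have Jh: "J h = r * I h" using Ih by (simp add: r_def)
      have 1: "J f \<le> I f * r + e"
      proof -
        have "J f * I h \<le> (I f * r + e) * I h" using * by (simp add: Jh algebra_simps)
        then show ?thesis using Ih(1) by (simp add: mult_le_cancel_right)
      qed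
      have 2: "I g * r \<le> J g + e * r"
      proof -
        have "(I g * r) * I h \<le> (J g + e * r) * I h" using ** by (simp add: Jh algebra_simps)
        then show ?thesis using Ih(1) by (simp add: mult_le_cancel_right)
      qed
      have "r \<le> R"
      proof -
        have "e * r \<le> I g / 2 * r" using e2 r by (intro mult_right_mono) auto
        with 2 have "I g * r \<le> 2 * J g" by (simp add: algebra_simps)
        then show ?thesis using Ig by (simp add: R_def pos_le_divide_eq mult.commute)
      qed
      have "J f * I g \<le> (I f * r + e) * I g" using 1 nn by (intro mult_right_mono) auto
      also have "\<dots> = I f * (I g * r) + e * I g" by (simp add: algebra_simps)
      also have "\<dots> \<le> I f * (J g + e * r) + e * I g" using 2 nn by (intro add_right_mono mult_left_mono) auto
      also have "\<dots> = I f * J g + e * (r * I f + I g)" by (simp add: algebra_simps)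
      also have "\<dots> \<le> I f * J g + e * D"
        using \<open>r \<le> R\<close> e nn mult_right_mono[OF \<open>r \<le> R\<close> nn(1)]
        by (intro add_left_mono mult_left_mono) (auto simp: D_def)
      also have "\<dots> \<le> I f * J g + \<epsilon>" using eD by simp
      finally show "J f * I g \<le> I f * J g + \<epsilon>" .
    qed
  qed
qed

lemma left_Haar_unique:
  fixes f g :: "'a::{topological_group_add, t2_space} \<Rightarrow> real"
  assumes "locally_compact_space (euclidean :: 'a topology)"
    and "left_Haar I" and "left_Haar J" and "Cc f" and "Cc g"
  shows "J f * I g = I f * J g"
  using left_Haar_ratio_le[OF assms] left_Haar_ratio_le[OF assms(1,3,2,4,5)]
  by (simp add: mult.commute)

section \<open>The content of compact sets\<close>

text \<open>
  The content of a compact set is its Haar measure. The definition through majorants in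
  \<open>Cc\<close> is used for compact sets only.
\<close>

context left_Haar
begin

definition content :: "'a set \<Rightarrow> real" where
  "content A = Inf {I g | g. Cc g \<and> (\<forall>x\<in>A. 1 \<le> g x)}"

lemma content_le: "Cc g \<Longrightarrow> (\<And>x. x \<in> A \<Longrightarrow> 1 \<le> g x) \<Longrightarrow> content A \<le> I g"
  unfolding content_def by (rule cInf_lower) (auto intro!: bdd_belowI[of _ 0] nonneg)

lemma content_greatest:
  assumes "compact A" "\<And>g. Cc g \<Longrightarrow> (\<And>x. x \<in> A \<Longrightarrow> 1 \<le> g x) \<Longrightarrow> b \<le> I g"
  shows "b \<le> content A"
  unfolding content_def
proof (rule cInf_greatest)
  obtain w where "Cc w" "\<And>x. x \<in> A \<Longrightarrow> 1 \<le> w x"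
    by (rule compact_majorant[OF assms(1)]) (rule that; assumption)
  then show "{I g | g. Cc g \<and> (\<forall>x\<in>A. 1 \<le> g x)} \<noteq> {}" by blast
qed (use assms(2) in blast)

lemma content_approx:
  assumes "compact A" "0 < e"
  obtains g where "Cc g" "\<And>x. x \<in> A \<Longrightarrow> 1 \<le> g x" "I g < content A + e"
proof (rule ccontr)
  assume neg: "\<not> thesis"
  note wanted = that
  have "content A + e \<le> I g" if g: "Cc g" "\<And>x. x \<in> A \<Longrightarrow> 1 \<le> g x" for g
  proof (rule ccontr)
    assume "\<not> content A + e \<le> I g"
    then have "I g < content A + e" by simp
    with g have thesis by (intro wanted[of g]) auto
    with neg show False by blast
  qed
  from content_greatest[OF assms(1) this] assms(2) show False by simp
qed

lemma content_nonneg: "compact A \<Longrightarrow> 0 \<le> content A"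
  by (rule content_greatest) (auto intro: nonneg)

lemma content_empty: "content {} = 0"
  using content_le[of "\<lambda>x. 0" "{}"] content_nonneg[of "{}"] zero by simp

lemma content_pos:
  assumes lc: "locally_compact_space (euclidean :: 'a topology)"
    and A: "compact A" "0 \<in> interior A"
  shows "0 < content A"
proof -
  obtain u where u: "Cc u" "\<And>x. u x \<le> 1" "u 0 = 1" "\<And>x. x \<notin> interior A \<Longrightarrow> u x = 0"
    by (rule Cc_bump_exists[OF lc open_interior A(2)]) (rule that; assumption)
  have "I u \<le> content A"
  proof (rule content_greatest[OF A(1)])
    fix g assume g: "Cc g" "\<And>x. x \<in> A \<Longrightarrow> 1 \<le> g x"
    have "u x \<le> g x" for x
    proof (cases "x \<in> A")
      case True
      then show ?thesis using u(2)[of x] g(2)[OF True] by linarith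
    next
      case False
      then have "x \<notin> interior A" using interior_subset by blast
      then show ?thesis using u(4) Cc_nonneg[OF g(1)] by simp
    qed
    then show "I u \<le> I g" by (intro mono u(1) g(1))
  qed
  moreover have "0 < I u" using pos[OF u(1), of 0] u(3) by simp
  ultimately show ?thesis by linarith
qed

text \<open>
  Scaling an almost optimal majorant \<open>g\<close> by a factor \<open>c\<close> slightly above \<open>1\<close> makes it a majorant of an
  open neighbourhood, at a cost controlled by \<open>c\<close>.
\<close>

lemma content_outer:
  assumes A: "compact A" and e: "0 < e"
  obtains U q where "open U" "A \<subseteq> U" "Cc q" "\<And>x. x \<in> U \<Longrightarrow> 1 \<le> q x" "I q \<le> content A + e"
proof -
  have e2: "0 < e / 2" using e by simp
  obtain g where g: "Cc g" "\<And>x. x \<in> A \<Longrightarrow> 1 \<le> g x" "I g < content A + e / 2"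
    by (rule content_approx[OF A e2]) (rule that; assumption)
  define c where "c = (I g + e / 2) / (I g + e / 4)"
  have Ig: "0 \<le> I g" by (rule nonneg[OF g(1)])
  have c: "1 < c" "c * I g \<le> I g + e / 2"
  proof -
    show "1 < c" using Ig e by (simp add: c_def)
    have "c * I g \<le> c * (I g + e / 4)" using \<open>1 < c\<close> e by (intro mult_left_mono) auto
    also have "\<dots> = I g + e / 2" using Ig e by (simp add: c_def)
    finally show "c * I g \<le> I g + e / 2" .
  qed
  show ?thesis
  proof (rule that[of "g -` {1 / c<..}" "\<lambda>x. c * g x"])
    show "open (g -` {1 / c<..})" by (intro open_vimage open_greaterThan Cc_continuous g(1))
    show "A \<subseteq> g -` {1 / c<..}"
    proof
      fix x assume "x \<in> A"
      then have "1 \<le> g x" by (rule g(2))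
      moreover have "1 / c < 1" using c(1) by simp
      ultimately show "x \<in> g -` {1 / c<..}" by simp
    qed
    show "Cc (\<lambda>x. c * g x)" using c(1) by (intro Cc_scale g(1)) auto
    show "1 \<le> c * g x" if "x \<in> g -` {1 / c<..}" for x
      using that c(1) by (simp add: pos_divide_less_eq mult.commute)
    have "I (\<lambda>x. c * g x) = c * I g" using c(1) g(1) by (intro scale) auto
    then show "I (\<lambda>x. c * g x) \<le> content A + e" using c(2) g(3) by linarith
  qed
qed

text \<open>
  Majorants \<open>g\<close> of \<open>A\<close> and \<open>h\<close> of \<open>B\<close> give the majorants \<open>max g h\<close> of the union and \<open>min g h\<close> of the
  intersection, with the same sum.
\<close>

lemma content_submodular:
  assumes "compact A" "compact B"
  shows "content (A \<union> B) + content (A \<inter> B) \<le> content A + content B"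
proof (rule field_le_epsilon)
  fix e :: real assume "0 < e"
  then have e: "0 < e / 2" by simp
  obtain g where g: "Cc g" "\<And>x. x \<in> A \<Longrightarrow> 1 \<le> g x" "I g < content A + e / 2"
    by (rule content_approx[OF assms(1) e]) (rule that; assumption)
  obtain h where h: "Cc h" "\<And>x. x \<in> B \<Longrightarrow> 1 \<le> h x" "I h < content B + e / 2"
    by (rule content_approx[OF assms(2) e]) (rule that; assumption)
  have "content (A \<union> B) \<le> I (\<lambda>x. max (g x) (h x))"
    by (rule content_le[OF Cc_max[OF g(1) h(1)]]) (use g(2) h(2) in \<open>auto simp: le_max_iff_disj\<close>)
  moreover have "content (A \<inter> B) \<le> I (\<lambda>x. min (g x) (h x))"
    by (rule content_le[OF Cc_min[OF g(1) h(1)]]) (use g(2) h(2) in auto)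
  moreover have "I (\<lambda>x. max (g x) (h x)) + I (\<lambda>x. min (g x) (h x)) = I g + I h"
  proof -
    have "I (\<lambda>x. max (g x) (h x)) + I (\<lambda>x. min (g x) (h x)) = I (\<lambda>x. max (g x) (h x) + min (g x) (h x))"
      by (rule add[symmetric, OF Cc_max[OF g(1) h(1)] Cc_min[OF g(1) h(1)]])
    also have "(\<lambda>x. max (g x) (h x) + min (g x) (h x)) = (\<lambda>x. g x + h x)"
      by (rule ext) (simp add: max_def min_def)
    also have "I (\<lambda>x. g x + h x) = I g + I h" by (rule add[OF g(1) h(1)])
    finally show ?thesis .
  qed
  ultimately show "content (A \<union> B) + content (A \<inter> B) \<le> content A + content B + e"
    using g(3) h(3) by linarith
qed

text \<open>
  Let \<open>p\<close> majorize the union, and let \<open>q\<close> majorize an open neighbourhood \<open>U\<close> of the intersection. Off \<open>U\<close> the sets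
  \<open>A\<close> and \<open>B\<close> are disjoint, and a Urysohn function \<open>t\<close> separating them splits \<open>p + q\<close> into a majorant
  \<open>g\<close> of \<open>A\<close> and a majorant \<open>h\<close> of \<open>B\<close>.
\<close>

lemma content_supermodular:
  assumes lc: "locally_compact_space (euclidean :: 'a topology)"
    and AB: "compact A" "compact B"
  shows "content A + content B \<le> content (A \<union> B) + content (A \<inter> B)"
proof (rule field_le_epsilon)
  fix e :: real assume "0 < e"
  then have e: "0 < e / 2" by simp
  have AB': "compact (A \<union> B)" "compact (A \<inter> B)"
    using AB by (auto intro: compact_Un compact_Int)
  obtain p where p: "Cc p" "\<And>x. x \<in> A \<union> B \<Longrightarrow> 1 \<le> p x" "I p < content (A \<union> B) + e / 2"
    by (rule content_approx[OF AB'(1) e]) (rule that; assumption)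
  obtain U q where U: "open U" "A \<inter> B \<subseteq> U" 
    and q: "Cc q" "\<And>x. x \<in> U \<Longrightarrow> 1 \<le> q x" "I q \<le> content (A \<inter> B) + e / 2"
    by (rule content_outer[OF AB'(2) e]) (rule that; assumption)
  have "closedin euclidean (A - U)" "compactin euclidean (B - U)" "disjnt (A - U) (B - U)"
    using AB U by (auto simp: disjnt_def compact_imp_closed closed_Diff compact_diff)
  then obtain t where t: "continuous_map euclidean (top_of_set {0..1::real}) t"
    "t ` (B - U) \<subseteq> {0}" "t ` (A - U) \<subseteq> {1}"
    using Urysohn_completely_regular_closed_compact[OF zero_le_one completely_regular_locally_compact[OF lc]]
    by metis
  have ct: "continuous_on UNIV t" and t01: "\<And>x. 0 \<le> t x" "\<And>x. t x \<le> 1"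
    using t(1) by (auto simp: continuous_map_in_subtopology)
  have tp: "Cc (\<lambda>x. t x * p x)" by (intro Cc_mult ct t01 p(1))
  have tp': "Cc (\<lambda>x. (1 - t x) * p x)" using t01(2) by (intro Cc_mult continuous_intros ct p(1)) simp
  define g where "g = (\<lambda>x. min (p x) (t x * p x + q x))"
  define h where "h = (\<lambda>x. max (q x) ((1 - t x) * p x))"
  have g: "Cc g" unfolding g_def by (intro Cc_min Cc_add tp p(1) q(1))
  have h: "Cc h" unfolding h_def by (intro Cc_max tp' q(1))
  have "content A \<le> I g"
  proof (rule content_le[OF g])
    fix x assume x: "x \<in> A"
    show "1 \<le> g x"
    proof (cases "x \<in> U")
      case True
      then show ?thesis using p(2)[of x] q(2)[of x] x Cc_nonneg[OF tp, of x] by (simp add: g_def)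
    next
      case False
      then have "t x = 1" using t(3) x by blast
      then show ?thesis using p(2)[of x] x Cc_nonneg[OF q(1), of x] by (simp add: g_def)
    qed
  qed
  moreover have "content B \<le> I h"
  proof (rule content_le[OF h])
    fix x assume x: "x \<in> B"
    show "1 \<le> h x"
    proof (cases "x \<in> U")
      case True
      then show ?thesis using q(2)[of x] by (simp add: h_def le_max_iff_disj)
    next
      case False
      then have "t x = 0" using t(2) x by blast
      then show ?thesis using p(2)[of x] x by (simp add: h_def le_max_iff_disj)
    qed
  qed
  moreover have "I g + I h = I p + I q"
  proof -
    have "I g + I h = I (\<lambda>x. g x + h x)" by (rule add[symmetric, OF g h])
    also have "(\<lambda>x. g x + h x) = (\<lambda>x. p x + q x)"
      by (rule ext) (simp add: g_def h_def max_def min_def algebra_simps)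
    also have "I (\<lambda>x. p x + q x) = I p + I q" by (rule add[OF p(1) q(1)])
    finally show ?thesis .
  qed
  ultimately show "content A + content B \<le> content (A \<union> B) + content (A \<inter> B) + e"
    using p(3) q(3) by linarith
qed

lemma content_left_le:
  assumes "compact A"
  shows "content ((+) a ` A) \<le> content A"
proof (rule content_greatest[OF assms])
  fix g assume g: "Cc g" "\<And>x. x \<in> A \<Longrightarrow> 1 \<le> g x"
  have "content ((+) a ` A) \<le> I (\<lambda>x. g (- a + x))"
    by (rule content_le[OF Cc_left[OF g(1)]]) (use g(2) in \<open>auto simp: add.assoc[symmetric]\<close>)
  then show "content ((+) a ` A) \<le> I g" by (simp add: left g(1))
qed

lemma compact_left_translate: "compact A \<Longrightarrow> compact ((+) a ` A)" for a :: 'a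
  by (intro compact_continuous_image continuous_intros)

lemma content_left:
  assumes "compact A"
  shows "content ((+) a ` A) = content A"
proof (rule antisym[OF content_left_le[OF assms]])
  have "content ((+) (- a) ` ((+) a ` A)) \<le> content ((+) a ` A)"
    by (rule content_left_le[OF compact_left_translate[OF assms]])
  then show "content A \<le> content ((+) a ` A)" by (simp add: image_image add.assoc[symmetric])
qed

lemma left_Haar_conj: "left_Haar (\<lambda>f. I (\<lambda>x. f (a + x - a)))"
proof
  fix f g :: "'a \<Rightarrow> real" and c :: real and b :: 'a
  show "\<exists>f. Cc f \<and> 0 < I (\<lambda>x. f (a + x - a))"
  proof -
    obtain f where f: "Cc f" "0 < I f" using nontrivial by blast
    have "(\<lambda>x. f (- a + (a + x - a) - (- a))) = f" by (rule ext) (simp only: group_normalize)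
    with f Cc_conj[OF f(1), of "- a"] show ?thesis
      by (intro exI[of _ "\<lambda>x. f (- a + x - (- a))"]) simp
  qed
  assume f: "Cc f"
  have f': "Cc (\<lambda>x. f (a + x - a))" by (rule Cc_conj[OF f])
  show "I (\<lambda>x. f (b + (a + x - a))) = I (\<lambda>x. f (a + x - a))"
  proof -
    have "(\<lambda>x. f (b + (a + x - a))) = (\<lambda>x. f (a + ((- a + b + a) + x) - a))"
      by (rule ext) (simp only: group_normalize)
    then show ?thesis using left[OF f', of "- a + b + a"] by simp
  qed
  show "I (\<lambda>x. c * f (a + x - a)) = c * I (\<lambda>x. f (a + x - a))" if "0 \<le> c"
    by (rule scale[OF that f'])
  assume g: "Cc g"
  show "I (\<lambda>x. f (a + x - a) + g (a + x - a)) = I (\<lambda>x. f (a + x - a)) + I (\<lambda>x. g (a + x - a))"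
    by (rule add[OF f' Cc_conj[OF g]])
  show "I (\<lambda>x. f (a + x - a)) \<le> I (\<lambda>x. g (a + x - a))" if "\<And>x. f x \<le> g x"
    by (rule mono[OF f' Cc_conj[OF g] that])
qed

text \<open>
  Composition with a conjugation is again a left Haar functional, hence a multiple of \<open>I\<close>. The factor is
  a value of the modular function of the group.
\<close>

lemma content_conj:
  assumes lc: "locally_compact_space (euclidean :: 'a topology)"
  obtains c where "\<And>A. compact A \<Longrightarrow> content A = c * content ((\<lambda>z. a + z - a) ` A)"
proof -
  obtain f0 where f0: "Cc f0" "0 < I f0" using nontrivial by blast
  define c where "c = I (\<lambda>x. f0 (a + x - a)) / I f0"
  have c: "0 \<le> c" using f0 Cc_conj[OF f0(1)] by (simp add: c_def nonneg)
  have Ic: "I (\<lambda>x. g (a + x - a)) = c * I g" if "Cc g" for g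
    using left_Haar_unique[OF lc left_Haar_axioms left_Haar_conj that f0(1), of a] f0(2)
    by (simp add: c_def field_simps)
  have inj: "- a + (a + x - a) - (- a) = x" for x by (simp only: group_normalize)
  show ?thesis
  proof (rule that)
    fix A :: "'a set" assume A: "compact A"
    let ?A = "(\<lambda>z. a + z - a) ` A"
    have A': "compact ?A" by (intro compact_continuous_image continuous_intros A)
    show "content A = c * content ?A"
    proof (rule antisym)
      show "content A \<le> c * content ?A"
      proof (rule field_le_epsilon)
        fix e :: real assume e: "0 < e"
        have e': "0 < e / (c + 1)" using e c by simp
        obtain g where g: "Cc g" "\<And>x. x \<in> ?A \<Longrightarrow> 1 \<le> g x" "I g < content ?A + e / (c + 1)"
          by (rule content_approx[OF A' e']) (rule that; assumption)
        have "content A \<le> I (\<lambda>x. g (a + x - a))"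
          by (rule content_le[OF Cc_conj[OF g(1)]]) (use g(2) in auto)
        also have "\<dots> = c * I g" by (rule Ic[OF g(1)])
        also have "\<dots> \<le> c * (content ?A + e / (c + 1))" using g(3) c by (intro mult_left_mono) auto
        also have "\<dots> = c * content ?A + c / (c + 1) * e" by (simp add: algebra_simps)
        also have "\<dots> \<le> c * content ?A + 1 * e"
          using c e by (intro add_left_mono mult_right_mono) (auto simp: divide_le_eq)
        finally show "content A \<le> c * content ?A + e" by simp
      qed
      show "c * content ?A \<le> content A"
      proof (rule content_greatest[OF A])
        fix g assume g: "Cc g" "\<And>x. x \<in> A \<Longrightarrow> 1 \<le> g x"
        define g' where "g' = (\<lambda>x. g (- a + x - (- a)))"
        have g': "Cc g'" unfolding g'_def by (rule Cc_conj[OF g(1)])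
        have "(\<lambda>x. g' (a + x - a)) = g" unfolding g'_def by (simp only: inj)
        then have "I g = c * I g'" using Ic[OF g'] by simp
        moreover have "content ?A \<le> I g'"
          by (rule content_le[OF g']) (use g(2) in \<open>auto simp: g'_def inj simp del: diff_minus_eq_add\<close>)
        ultimately show "c * content ?A \<le> I g" using c by (simp add: mult_left_mono)
      qed
    qed
  qed
qed

end

section \<open>IN-groups\<close>

text \<open>
  For \<open>x\<close> near \<open>x0\<close> the set \<open>K \<inter> (x + K)\<close> lies in a given neighbourhood of \<open>K \<inter> (x0 + K)\<close>, so by outer
  regularity the content of the intersection is upper semicontinuous in \<open>x\<close>. The same holds for the union, and
  by modularity and left invariance the contents of the two have the constant sum \<open>2 content K\<close>.
  This gives lower semicontinuity.
\<close>

lemma (in left_Haar) continuous_content_Int_translate: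
  assumes lc: "locally_compact_space (euclidean :: 'a topology)" and K: "compact K"
  shows "continuous_on UNIV (\<lambda>x. content (K \<inter> (+) x ` K))"
  unfolding continuous_on_def
proof (intro ballI tendstoI)
  fix x0 :: 'a and e :: real assume "0 < e"
  then have e: "0 < e / 2" by simp
  define F where "F = (\<lambda>x. content (K \<inter> (+) x ` K))"
  have xK: "compact ((+) x ` K)" for x by (rule compact_left_translate[OF K])
  have Int: "compact (K \<inter> (+) x ` K)" and Un: "compact (K \<union> (+) x ` K)" for x
    using K xK by (auto intro: compact_Int compact_Un)
  have F_eq: "F x = 2 * content K - content (K \<union> (+) x ` K)" for x
    using content_submodular[OF K xK, of x] content_supermodular[OF lc K xK, of x] content_left[OF K, of x]
    by (simp add: F_def)
  obtain U q where U: "open U" "K \<inter> (+) x0 ` K \<subseteq> U"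
    and q: "Cc q" "\<And>x. x \<in> U \<Longrightarrow> 1 \<le> q x" "I q \<le> content (K \<inter> (+) x0 ` K) + e / 2"
    by (rule content_outer[OF Int e]) (rule that; assumption)
  define D where "D = K - U"
  have D: "compact D" unfolding D_def by (rule compact_diff[OF K U(1)])
  define T where "T = (\<lambda>p. - fst p + snd p) -` (- K)"
  have T: "open T"
    unfolding T_def using compact_imp_closed[OF K] by (intro open_vimage open_Compl continuous_intros)
  have "{x0} \<times> D \<subseteq> T"
  proof
    fix p assume "p \<in> {x0} \<times> D"
    then obtain k where k: "p = (x0, k)" "k \<in> K" "k \<notin> U" by (auto simp: D_def)
    have "- x0 + k \<notin> K"
    proof
      assume "- x0 + k \<in> K"
      then have "x0 + (- x0 + k) \<in> (+) x0 ` K" by blast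
      then have "k \<in> (+) x0 ` K" by (simp only: group_normalize)
      with k U(2) show False by blast
    qed
    then show "p \<in> T" by (simp add: T_def k(1))
  qed
  from Elementary_Topology.tube_lemma[OF D T this]
  obtain W where W: "x0 \<in> W" "open W" "W \<times> D \<subseteq> T" by blast
  have upper: "F x < F x0 + e" if x: "x \<in> W" for x
  proof -
    have sub: "K \<inter> (+) x ` K \<subseteq> U"
    proof
      fix k assume k: "k \<in> K \<inter> (+) x ` K"
      show "k \<in> U"
      proof (rule ccontr)
        assume "k \<notin> U"
        with k x W(3) have "(x, k) \<in> T" by (auto simp: D_def)
        then have "- x + k \<notin> K" by (simp add: T_def)
        moreover from k obtain k' where "k' \<in> K" "k = x + k'" by blast
        ultimately show False by (simp add: add.assoc[symmetric])
      qed
    qed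
    have "F x \<le> I q" unfolding F_def by (rule content_le[OF q(1)]) (use sub q(2) in blast)
    then show ?thesis using q(3) e unfolding F_def by linarith
  qed
  obtain U' q' where U': "open U'" "K \<union> (+) x0 ` K \<subseteq> U'"
    and q': "Cc q'" "\<And>x. x \<in> U' \<Longrightarrow> 1 \<le> q' x" "I q' \<le> content (K \<union> (+) x0 ` K) + e / 2"
    by (rule content_outer[OF Un e]) (rule that; assumption)
  define T' where "T' = (\<lambda>p. fst p + snd p) -` U'"
  have T': "open T'" unfolding T'_def by (intro open_vimage U'(1) continuous_intros)
  have "{x0} \<times> K \<subseteq> T'" using U'(2) by (auto simp: T'_def)
  from Elementary_Topology.tube_lemma[OF K T' this]
  obtain W' where W': "x0 \<in> W'" "open W'" "W' \<times> K \<subseteq> T'" by blast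
  have lower: "F x0 - e < F x" if x: "x \<in> W'" for x
  proof -
    have sub: "K \<union> (+) x ` K \<subseteq> U'" using x W'(3) U'(2) by (auto simp: T'_def)
    have "content (K \<union> (+) x ` K) \<le> I q'" by (rule content_le[OF q'(1)]) (use sub q'(2) in blast)
    then show ?thesis using q'(3) e unfolding F_eq by linarith
  qed
  have "dist (F x) (F x0) < e" if "x \<in> W \<inter> W'" for x
    using upper[of x] lower[of x] that unfolding dist_real_def by auto
  moreover have "open (W \<inter> W')" "x0 \<in> W \<inter> W'" using W W' by auto
  ultimately show "\<forall>\<^sub>F x in at x0 within UNIV. dist (content (K \<inter> (+) x ` K)) (content (K \<inter> (+) x0 ` K)) < e"
    unfolding eventually_at_topological F_def by blast
qed

text \<open>
  The factor in \<open>content_conj\<close> is \<open>1\<close>, as an invariant compact neighbourhood has positive content: the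
  existence of \<open>K\<close> makes the group unimodular.
\<close>

lemma (in left_Haar) content_conj_invariant:
  fixes K A :: "'a set"
  assumes lc: "locally_compact_space (euclidean :: 'a topology)"
    and K: "compact K" "0 \<in> interior K" "\<And>x. (\<lambda>z. x + z - x) ` K = K" and A: "compact A"
  shows "content ((\<lambda>z. a + z - a) ` A) = content A"
proof -
  obtain c where c: "\<And>A. compact A \<Longrightarrow> content A = c * content ((\<lambda>z. a + z - a) ` A)"
    by (rule content_conj[OF lc, of a]) (rule that; assumption)
  have "content K = c * content K" using c[OF K(1)] unfolding K(3) .
  then have "c = 1" using content_pos[OF lc K(1,2)] by simp
  then show ?thesis using c[OF A] by simp
qed

text \<open>
  \<open>x \<mapsto> content (K \<inter> (x + K))\<close> is a central bump: it vanishes off the compact set \<open>K - K\<close>, and a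
  conjugation maps \<open>K \<inter> (x + K)\<close> to \<open>K \<inter> (y + K)\<close>, where \<open>y\<close> is the conjugate of \<open>x\<close>.
\<close>

lemma IN_WS_minus_AP:
  assumes lc: "locally_compact_space (euclidean :: 'a::{topological_group_add, t2_space} topology)"
    and nc: "\<not> compact (UNIV :: 'a set)"
    and "IN_group TYPE('a)"
  shows "\<exists>f :: 'a \<Rightarrow>\<^sub>C complex. f \<in> WS \<and> f \<notin> AP"
proof -
  obtain K :: "'a set" where K: "compact K" "0 \<in> interior K" "\<And>x. (\<lambda>z. x + z - x) ` K = K"
    using assms(3) unfolding IN_group_def by blast
  obtain I :: "('a \<Rightarrow> real) \<Rightarrow> real" where "left_Haar I" using left_Haar_exists[OF lc] by blast
  then interpret left_Haar I .
  define F where "F = (\<lambda>x. content (K \<inter> (+) x ` K))"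
  have cpt: "compact (K \<inter> (+) x ` K)" for x
    by (intro compact_Int K(1) compact_left_translate)
  let ?S = "{a + b | a b. a \<in> K \<and> b \<in> uminus ` K}"
  have S: "compact ?S" by (intro compact_sum_set compact_uminus_set K(1))
  have supp: "x \<in> ?S" if "F x \<noteq> 0" for x
  proof -
    have "K \<inter> (+) x ` K \<noteq> {}" using that content_empty by (auto simp: F_def)
    then obtain k k' where k: "k \<in> K" "k' \<in> K" "k = x + k'" by blast
    have "x = k + - k'" unfolding k(3) by (simp only: group_normalize)
    then show ?thesis using k by blast
  qed
  have "Cc F"
  proof (rule CcI[OF _ _ S])
    show "continuous_on UNIV F" unfolding F_def by (rule continuous_content_Int_translate[OF lc K(1)])
    show "0 \<le> F x" for x unfolding F_def by (rule content_nonneg[OF cpt])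
    show "F x = 0" if "x \<notin> ?S" for x using supp that by blast
  qed
  have conj: "F (a + x - a) = F x" for a x
  proof -
    define \<alpha> where "\<alpha> = (\<lambda>z. a + z - a)"
    have "inj \<alpha>" unfolding \<alpha>_def
      by (rule injI) (metis add_left_cancel add_right_cancel diff_conv_add_uminus)
    have "\<alpha> ` ((+) x ` K) = (+) (\<alpha> x) ` (\<alpha> ` K)"
      unfolding image_image \<alpha>_def by (simp only: group_normalize)
    moreover have "\<alpha> ` K = K" unfolding \<alpha>_def by (rule K(3))
    ultimately have "\<alpha> ` (K \<inter> (+) x ` K) = K \<inter> (+) (\<alpha> x) ` K"
      by (simp only: image_Int[OF \<open>inj \<alpha>\<close>])
    then show ?thesis
      using content_conj_invariant[OF lc K cpt[of x], of a] by (simp add: F_def \<alpha>_def)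
  qed
  obtain M where M: "0 < M" "\<And>x. F x \<le> M"
    by (rule Cc_bounded[OF \<open>Cc F\<close>]) (rule that; assumption)
  show ?thesis
  proof (rule central_bump_in_WS_minus_AP[OF _ not_cocompact_trivial[OF nc] _
        Cc_translation_continuous[OF \<open>Cc F\<close>] _ _ _ S])
    show "normal_subgroup_add {0 :: 'a}" by (simp add: normal_subgroup_add_def)
    show "\<bar>F x\<bar> \<le> M" for x using M(2) Cc_nonneg[OF \<open>Cc F\<close>, of x] by simp
    have "F 0 = content K" by (simp add: F_def)
    then show "F 0 \<noteq> 0" using content_pos[OF lc K(1,2)] by simp
    show "F (x + y) = F (y + x)" for x y
    proof -
      have "y + x = y + (x + y) - y" by (simp only: group_normalize)
      then show ?thesis using conj[of y "x + y"] by simp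
    qed
    show "F (x + n) = F x" if "n \<in> {0}" for x n using that by simp
    show "\<exists>s\<in>?S. \<exists>n\<in>{0}. x = s + n" if "F x \<noteq> 0" for x using supp[OF that] by auto
  qed
qed

section \<open>The strict inclusions\<close>

theorem theorem3p2:
  assumes "locally_compact_space (euclidean :: 'a::{topological_group_add, t2_space} topology)"
    and "\<not> compact (UNIV :: 'a set)"
  shows "(IN_group TYPE('a) \<longrightarrow> (AP :: ('a \<Rightarrow>\<^sub>C complex) set) \<subset> WS) \<and>
         (nilpotent_group TYPE('a) \<longrightarrow> (AP :: ('a \<Rightarrow>\<^sub>C complex) set) \<subset> WS)"
  using AP_subset_WS IN_WS_minus_AP[OF assms] nilpotent_WS_minus_AP[OF assms] by blast

end
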